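(* Let $g$ be a positive integer and let $A$ be a $g \times 5$ matrix with entries in $\mathbf{R}$ whose tropical rank is $3$. Then the Kapranov rank of $A$ is also $3$.
   Context: The tropical semiring is $(\mathbf{R}, \oplus, \odot)$ with $x \oplus y := \min\{x,y\}$ and $x \odot y := x+y$. For a square real $r\times r$ matrix $B=(b_{i,j})$, the tropical determinant is $\det(B) := \min_{\sigma \in S_r}\{b_{1,\sigma(1)}+\cdots+b_{r,\sigma(r)}\}$, where $S_r$ is the symmetric group. $B$ is called singular if this minimum is attained by at least two different permutations $\sigma\in S_r$, and nonsingular otherwise. The tropical rank $rk_t(M)$ of a real $m \times n$ matrix $M$ is the largest $r$ such that $M$ has a nonsingular $r\times r$ submatrix (obtained by choosing $r$ rows and $r$ columns). Let $\tilde K$ be the field of generalized power series in $\tau$ with complex coefficients and real exponents (formal sums $\sum_{a} c_a \tau^{a}$ with $c_a\in\mathbf{C}$, $a \in \mathbf{R}$, with well-ordered support). For $0\neq f\in\tilde K$, let $ord(f)\in\mathbf{R}$ be the smallest exponent occurring in $f$ with nonzero coefficient; $ord$ is applied entrywise to vectors and matrices with nonzero entries. A tropical linear space of dimension $r$ in $\mathbf{R}^m$ is a set of the form $ord\big(V\cap(\tilde K\setminus\{0\})^m\big)$, where $V\subseteq \tilde K^m$ is a linear subspace of dimension $r$ over $\tilde K$. The Kapranov rank $rk_K(M)$ of a real $m\times n$ matrix $M$ is the smallest $r$ such that some tropical linear space of dimension $r$ in $\mathbf{R}^m$ contains all the columns of $M$. Equivalently, it is the smallest $r$ such that there is an $m\times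 n$ matrix $F$ with entries in $\tilde K\setminus\{0\}$, of rank at most $r$ over $\tilde K$, with $ord(F)=M$ (such an $F$ is called a lift of $M$). *)

theory Defs
  imports "HOL-Analysis.Analysis"
begin

definition well_ordered :: "real set \<Rightarrow> bool" where
  "well_ordered S \<longleftrightarrow> (\<forall>T\<subseteq>S. T \<noteq> {} \<longrightarrow> (\<exists>m\<in>T. \<forall>x\<in>T. m \<le> x))"

lemma well_ordered_subset: "well_ordered S \<Longrightarrow> T \<subseteq> S \<Longrightarrow> well_ordered T"
  unfolding well_ordered_def by (meson subset_trans)

lemma well_ordered_no_descent:
  assumes "well_ordered S" "\<And>n. s n \<in> S"
  shows "\<exists>n::nat. s n \<le> s (Suc n)"
proof -
  have "range s \<subseteq> S" "range s \<noteq> {}" using assms(2) by auto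
  then obtain m where "m \<in> range s" "\<forall>x\<in>range s. m \<le> x"
    using assms(1) unfolding well_ordered_def by meson
  then show ?thesis by auto
qed

lemma well_ordered_if_no_descent:
  assumes "\<And>s::nat \<Rightarrow> real. (\<And>n. s n \<in> S) \<Longrightarrow> \<exists>n. s n \<le> s (Suc n)"
  shows "well_ordered S"
  unfolding well_ordered_def
proof (intro allI impI, rule ccontr)
  fix T assume T: "T \<subseteq> S" "T \<noteq> {}" and no: "\<not> (\<exists>m\<in>T. \<forall>x\<in>T. m \<le> x)"
  have "\<exists>s. \<forall>n. s n \<in> T \<and> s (Suc n) < s n"
  proof (rule dependent_nat_choice)
    show "\<exists>x. x \<in> T" using T by auto
    fix x :: real and n :: nat assume "x \<in> T"
    then show "\<exists>y. y \<in> T \<and> y < x" using no by (meson not_le)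
  qed
  then obtain s where s: "\<And>n. s n \<in> T" "\<And>n. s (Suc n) < s n" by auto
  then show False using assms[of s] T by (meson not_le subsetD)
qed

lemma well_ordered_Un:
  assumes "well_ordered A" "well_ordered B"
  shows "well_ordered (A \<union> B)"
  unfolding well_ordered_def
proof (intro allI impI)
  fix T assume T: "T \<subseteq> A \<union> B" "T \<noteq> {}"
  have a: "T \<inter> A = {} \<or> (\<exists>m\<in>T \<inter> A. \<forall>x\<in>T \<inter> A. m \<le> x)"
    using assms(1) unfolding well_ordered_def by (meson inf_le2)
  have b: "T \<inter> B = {} \<or> (\<exists>m\<in>T \<inter> B. \<forall>x\<in>T \<inter> B. m \<le> x)"
    using assms(2) unfolding well_ordered_def by (meson inf_le2)
  have split: "\<And>x. x \<in> T \<Longrightarrow> x \<in> T \<inter> A \<or> x \<in> T \<inter> B" using T by blast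
  show "\<exists>m\<in>T. \<forall>x\<in>T. m \<le> x"
  proof (cases "T \<inter> A = {}")
    case True
    then have "T \<inter> B = T" using T by blast
    then show ?thesis using b T by auto
  next
    case False
    then obtain m where m: "m \<in> T \<inter> A" "\<forall>x\<in>T \<inter> A. m \<le> x" using a by auto
    show ?thesis
    proof (cases "T \<inter> B = {}")
      case True
      then show ?thesis using m split by blast
    next
      case False
      then obtain n where n: "n \<in> T \<inter> B" "\<forall>x\<in>T \<inter> B. n \<le> x" using b by auto
      have "min m n \<in> T" using m n by (simp add: min_def)
      moreover have "\<forall>x\<in>T. min m n \<le> x" using split m(2) n(2) by (meson min.coboundedI1 min.coboundedI2)
      ultimately show ?thesis by blast
    qed
  qed
qed

lemma well_ordered_sums:
  assumes A: "well_ordered A" and B: "well_ordered B"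
  shows "well_ordered {a + b |a b. a \<in> A \<and> b \<in> B}"
proof (rule well_ordered_if_no_descent, rule ccontr)
  fix s :: "nat \<Rightarrow> real"
  assume s: "\<And>n. s n \<in> {a + b |a b. a \<in> A \<and> b \<in> B}" and "\<not> (\<exists>n. s n \<le> s (Suc n))"
  then have dec: "\<And>n. s (Suc n) < s n" by (meson not_le)
  have less: "s j < s i" if "i < j" for i j
    using that by (induction rule: less_Suc_induct) (use dec in \<open>auto intro: less_trans\<close>)
  have "\<forall>n. \<exists>p. s n = fst p + snd p \<and> fst p \<in> A \<and> snd p \<in> B" using s by fastforce
  then obtain p where p: "\<And>n. s n = fst (p n) + snd (p n)" "\<And>n. fst (p n) \<in> A" "\<And>n. snd (p n) \<in> B"
    by metis
  obtain r :: "nat \<Rightarrow> nat" where r: "strict_mono r" "monoseq (\<lambda>n. fst (p (r n)))"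
    using seq_monosub[of "\<lambda>n. fst (p n)"] by blast
  obtain k where k: "\<And>n. n \<ge> k \<Longrightarrow> fst (p (r n)) \<le> fst (p (r (Suc n)))"
  proof (cases "incseq (\<lambda>n. fst (p (r n)))")
    case True
    then have "\<And>n. fst (p (r n)) \<le> fst (p (r (Suc n)))" by (rule incseq_SucD)
    then show thesis by (rule that[of 0])
  next
    case False
    then have d: "decseq (\<lambda>n. fst (p (r n)))" using r(2) monoseq_iff by blast
    have "range (\<lambda>n. fst (p (r n))) \<subseteq> A" "range (\<lambda>n. fst (p (r n))) \<noteq> {}" using p(2) by auto
    then obtain m where "m \<in> range (\<lambda>n. fst (p (r n)))" "\<forall>x\<in>range (\<lambda>n. fst (p (r n))). m \<le> x"
      using A unfolding well_ordered_def by meson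
    then obtain k where "\<And>n. fst (p (r k)) \<le> fst (p (r n))" by auto
    then have "\<And>n. k \<le> n \<Longrightarrow> fst (p (r n)) \<le> fst (p (r (Suc n)))"
      using order_trans[OF decseqD[OF d]] by blast
    then show thesis by (rule that)
  qed
  obtain n where n: "snd (p (r (k + n))) \<le> snd (p (r (k + Suc n)))"
    using well_ordered_no_descent[OF B, of "\<lambda>n. snd (p (r (k + n)))"] p(3) by auto
  have "s (r (k + Suc n)) < s (r (k + n))"
    using r(1) by (intro less) (simp add: strict_mono_Suc_iff)
  then show False using n k[of "k + n"] p(1) by (smt (verit) add_Suc_right le_add1)
qed

lemma finite_if_both_well_ordered:
  fixes S :: "real set"
  assumes "\<And>T. T \<subseteq> S \<Longrightarrow> T \<noteq> {} \<Longrightarrow> \<exists>m\<in>T. \<forall>x\<in>T. m \<le> x"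
    and "\<And>T. T \<subseteq> S \<Longrightarrow> T \<noteq> {} \<Longrightarrow> \<exists>m\<in>T. \<forall>x\<in>T. x \<le> m"
  shows "finite S"
proof (rule ccontr)
  assume inf: "infinite S"
  define I where "I = {x\<in>S. finite {y\<in>S. y \<le> x}}"
  obtain m where m: "m \<in> S" "\<forall>x\<in>S. m \<le> x" using assms(1)[of S] inf by auto
  have "{y\<in>S. y \<le> m} = {m}" using m by force
  then have "m \<in> I" using m by (simp add: I_def)
  then obtain M where M: "M \<in> I" "\<forall>x\<in>I. x \<le> M" using assms(2)[of I] unfolding I_def by blast
  have fin: "finite {y\<in>S. y \<le> M}" using M(1) by (simp add: I_def)
  then have "{y\<in>S. \<not> y \<le> M} \<noteq> {}" using inf
    by (metis (mono_tags, lifting) empty_Collect_eq finite_subset mem_Collect_eq subsetI)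
  then obtain k where k: "k \<in> S" "M < k" "\<forall>x\<in>{y\<in>S. \<not> y \<le> M}. k \<le> x"
    using assms(1)[of "{y\<in>S. \<not> y \<le> M}"] by (auto simp: not_le)
  have "{y\<in>S. y \<le> k} \<subseteq> insert k {y\<in>S. y \<le> M}" using k(3) by force
  then have "finite {y\<in>S. y \<le> k}" using fin finite_subset by blast
  then have "k \<in> I" using k by (simp add: I_def)
  then show False using M k by force
qed

lemma well_ordered_finite_fibre:
  assumes A: "well_ordered A" and B: "well_ordered B"
  shows "finite {a \<in> A. c - a \<in> B}"
proof (rule finite_if_both_well_ordered)
  fix T assume T: "T \<subseteq> {a \<in> A. c - a \<in> B}" "T \<noteq> {}"
  then have "T \<subseteq> A" by auto
  then show "\<exists>m\<in>T. \<forall>x\<in>T. m \<le> x" using A T(2) unfolding well_ordered_def by blast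
  have "(\<lambda>a. c - a) ` T \<subseteq> B" "(\<lambda>a. c - a) ` T \<noteq> {}" using T by auto
  then obtain b where "b \<in> (\<lambda>a. c - a) ` T" "\<forall>x\<in>(\<lambda>a. c - a) ` T. b \<le> x"
    using B unfolding well_ordered_def by meson
  then obtain m where "m \<in> T" "\<forall>x\<in>T. c - m \<le> c - x" by auto
  then show "\<exists>m\<in>T. \<forall>x\<in>T. x \<le> m" by (intro bexI[of _ m]) auto
qed

typedef gps = "{f :: real \<Rightarrow> complex. well_ordered {a. f a \<noteq> 0}}"
  morphisms coeff Abs_gps
  by (rule exI[of _ "\<lambda>_. 0"]) (simp add: well_ordered_def)

setup_lifting type_definition_gps

lemma well_ordered_supp: "well_ordered {a. coeff f a \<noteq> 0}"
  using coeff by simp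

lemma gps_eqI: "(\<And>a. coeff f a = coeff g a) \<Longrightarrow> f = g"
  using coeff_inject by blast

lemma finite_conv_supp: "finite {a. coeff f a \<noteq> 0 \<and> coeff g (c - a) \<noteq> 0}"
  using well_ordered_finite_fibre[OF well_ordered_supp[of f] well_ordered_supp[of g], of c] by simp

lemma well_ordered_supp_sums: "well_ordered {a + b |a b. coeff f a \<noteq> 0 \<and> coeff g b \<noteq> 0}"
  using well_ordered_sums[OF well_ordered_supp[of f] well_ordered_supp[of g]] by simp

instantiation gps :: comm_ring_1
begin

lift_definition zero_gps :: gps is "\<lambda>_. 0"
  by (simp add: well_ordered_def)

lift_definition one_gps :: gps is "\<lambda>a. if a = 0 then 1 else 0"
  by (auto simp: well_ordered_def)

lift_definition plus_gps :: "gps \<Rightarrow> gps \<Rightarrow> gps" is "\<lambda>f g a. f a + g a"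
  by (erule (1) well_ordered_subset[OF well_ordered_Un]) auto

lift_definition uminus_gps :: "gps \<Rightarrow> gps" is "\<lambda>f a. - f a"
  by simp

lift_definition minus_gps :: "gps \<Rightarrow> gps \<Rightarrow> gps" is "\<lambda>f g a. f a - g a"
  by (erule (1) well_ordered_subset[OF well_ordered_Un]) auto

text \<open>The Cauchy product; the index set is finite because both supports are well-ordered.\<close>

lift_definition times_gps :: "gps \<Rightarrow> gps \<Rightarrow> gps" is
  "\<lambda>f g c. \<Sum>a | f a \<noteq> 0 \<and> g (c - a) \<noteq> 0. f a * g (c - a)"
proof -
  fix f g :: "real \<Rightarrow> complex"
  assume fg: "well_ordered {a. f a \<noteq> 0}" "well_ordered {a. g a \<noteq> 0}"
  show "well_ordered {c. (\<Sum>a | f a \<noteq> 0 \<and> g (c - a) \<noteq> 0. f a * g (c - a)) \<noteq> 0}"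
  proof (rule well_ordered_subset[OF well_ordered_sums[OF fg]], rule subsetI)
    fix c assume "c \<in> {c. (\<Sum>a | f a \<noteq> 0 \<and> g (c - a) \<noteq> 0. f a * g (c - a)) \<noteq> 0}"
    then have nz: "(\<Sum>a | f a \<noteq> 0 \<and> g (c - a) \<noteq> 0. f a * g (c - a)) \<noteq> 0" by (rule CollectD)
    have "{a. f a \<noteq> 0 \<and> g (c - a) \<noteq> 0} \<noteq> {}"
    proof
      assume "{a. f a \<noteq> 0 \<and> g (c - a) \<noteq> 0} = {}"
      then show False using nz by (simp only: sum.empty)
    qed
    then obtain a where "f a \<noteq> 0" "g (c - a) \<noteq> 0" by blast
    then show "c \<in> {a + b |a b. a \<in> {a. f a \<noteq> 0} \<and> b \<in> {a. g a \<noteq> 0}}"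
      by (intro CollectI exI[of _ a] exI[of _ "c - a"]) simp
  qed
qed

lemma coeff_times:
  assumes "finite S" "\<And>a. coeff f a \<noteq> 0 \<Longrightarrow> coeff g (c - a) \<noteq> 0 \<Longrightarrow> a \<in> S"
  shows "coeff (f * g) c = (\<Sum>a\<in>S. coeff f a * coeff g (c - a))"
  unfolding times_gps.rep_eq using assms by (intro sum.mono_neutral_left) auto

lemma coeff_times_nonzeroE:
  assumes "coeff (f * g) c \<noteq> 0"
  obtains a where "coeff f a \<noteq> 0" "coeff g (c - a) \<noteq> 0"
proof -
  have "{a. coeff f a \<noteq> 0 \<and> coeff g (c - a) \<noteq> 0} \<noteq> {}"
  proof
    assume "{a. coeff f a \<noteq> 0 \<and> coeff g (c - a) \<noteq> 0} = {}"
    then have "coeff (f * g) c = 0" unfolding times_gps.rep_eq by (simp only: sum.empty)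
    then show False using assms by simp
  qed
  then show thesis using that by blast
qed

lemma gps_mult_commute: "f * g = g * (f :: gps)"
proof (rule gps_eqI)
  fix c
  show "coeff (f * g) c = coeff (g * f) c" unfolding times_gps.rep_eq
    by (rule sum.reindex_bij_witness[of _ "\<lambda>a. c - a" "\<lambda>a. c - a"]) auto
qed

lemma gps_distrib_right: "(f + g) * h = f * h + g * (h :: gps)"
proof (rule gps_eqI)
  fix c
  define S where "S = {a. coeff f a \<noteq> 0 \<and> coeff h (c - a) \<noteq> 0} \<union> {a. coeff g a \<noteq> 0 \<and> coeff h (c - a) \<noteq> 0}"
  have fin: "finite S" unfolding S_def using finite_conv_supp by blast
  have "coeff (f * h) c = (\<Sum>a\<in>S. coeff f a * coeff h (c - a))"
    "coeff (g * h) c = (\<Sum>a\<in>S. coeff g a * coeff h (c - a))"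
    "coeff ((f + g) * h) c = (\<Sum>a\<in>S. coeff (f + g) a * coeff h (c - a))"
    by (rule coeff_times[OF fin]; auto simp: S_def plus_gps.rep_eq)+
  then show "coeff ((f + g) * h) c = coeff (f * h + g * h) c"
    by (simp add: plus_gps.rep_eq distrib_right sum.distrib)
qed

lemma gps_mult_assoc: "f * g * h = f * (g * (h :: gps))"
proof (rule gps_eqI)
  fix d
  define E where "E = {e. (\<exists>a. coeff f a \<noteq> 0 \<and> coeff g (e - a) \<noteq> 0) \<and> coeff h (d - e) \<noteq> 0}"
  define A where "A = {a. coeff f a \<noteq> 0 \<and> (\<exists>b. coeff g b \<noteq> 0 \<and> coeff h (d - a - b) \<noteq> 0)}"
  have "finite {e \<in> {a + b |a b. coeff f a \<noteq> 0 \<and> coeff g b \<noteq> 0}. d - e \<in> {c. coeff h c \<noteq> 0}}"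
    by (rule well_ordered_finite_fibre[OF well_ordered_supp_sums well_ordered_supp])
  then have finE: "finite E" by (rule rev_finite_subset) (force simp: E_def)
  have "finite {a \<in> {a. coeff f a \<noteq> 0}. d - a \<in> {b + c |b c. coeff g b \<noteq> 0 \<and> coeff h c \<noteq> 0}}"
    by (rule well_ordered_finite_fibre[OF well_ordered_supp well_ordered_supp_sums])
  then have finA: "finite A"
  proof (rule rev_finite_subset, intro subsetI)
    fix a assume "a \<in> A"
    then obtain b where "coeff f a \<noteq> 0" "coeff g b \<noteq> 0" "coeff h (d - a - b) \<noteq> 0" by (auto simp: A_def)
    moreover have "d - a = b + (d - a - b)" by simp
    ultimately show "a \<in> {a \<in> {a. coeff f a \<noteq> 0}. d - a \<in> {b + c |b c. coeff g b \<noteq> 0 \<and> coeff h c \<noteq> 0}}"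
      by blast
  qed
  have "coeff (f * g * h) d = (\<Sum>e\<in>E. coeff (f * g) e * coeff h (d - e))"
    by (rule coeff_times[OF finE]) (auto simp: E_def elim: coeff_times_nonzeroE)
  also have "\<dots> = (\<Sum>e\<in>E. \<Sum>a | coeff f a \<noteq> 0 \<and> coeff g (e - a) \<noteq> 0. coeff f a * coeff g (e - a) * coeff h (d - e))"
    by (simp add: times_gps.rep_eq sum_distrib_right)
  also have "\<dots> = (\<Sum>(e, a)\<in>(SIGMA e:E. {a. coeff f a \<noteq> 0 \<and> coeff g (e - a) \<noteq> 0}).
      coeff f a * coeff g (e - a) * coeff h (d - e))"
    by (rule sum.Sigma) (use finE finite_conv_supp in auto)
  also have "\<dots> = (\<Sum>(a, b)\<in>(SIGMA a:A. {b. coeff g b \<noteq> 0 \<and> coeff h (d - a - b) \<noteq> 0}).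
      coeff f a * (coeff g b * coeff h (d - a - b)))"
    by (rule sum.reindex_bij_witness[of _ "\<lambda>(a, b). (a + b, a)" "\<lambda>(e, a). (a, e - a)"])
      (auto simp: E_def A_def algebra_simps)
  also have "\<dots> = (\<Sum>a\<in>A. \<Sum>b | coeff g b \<noteq> 0 \<and> coeff h (d - a - b) \<noteq> 0. coeff f a * (coeff g b * coeff h (d - a - b)))"
    by (rule sum.Sigma[symmetric]) (use finA finite_conv_supp in auto)
  also have "\<dots> = (\<Sum>a\<in>A. coeff f a * coeff (g * h) (d - a))"
    by (simp add: times_gps.rep_eq sum_distrib_left)
  also have "\<dots> = coeff (f * (g * h)) d"
    by (rule coeff_times[OF finA, symmetric]) (auto simp: A_def elim: coeff_times_nonzeroE)
  finally show "coeff (f * g * h) d = coeff (f * (g * h)) d" .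
qed

lemma gps_one_mult: "1 * f = (f :: gps)"
proof (rule gps_eqI)
  fix c
  have "coeff (1 * f) c = (\<Sum>a\<in>{0}. coeff 1 a * coeff f (c - a))"
    by (rule coeff_times) (auto simp: one_gps.rep_eq split: if_splits)
  then show "coeff (1 * f) c = coeff f c" by (simp add: one_gps.rep_eq)
qed

instance
proof
  fix f g h :: gps
  show "f * g * h = f * (g * h)" by (rule gps_mult_assoc)
  show "f * g = g * f" by (rule gps_mult_commute)
  show "1 * f = f" by (rule gps_one_mult)
  show "(f + g) * h = f * h + g * h" by (rule gps_distrib_right)
  show "f + g + h = f + (g + h)" by transfer (simp add: add.assoc)
  show "f + g = g + f" by transfer (simp add: add.commute)
  show "0 + f = f" by transfer simp
  show "- f + f = 0" by transfer simp
  show "f - g = f + - g" by transfer simp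
  show "(0 :: gps) \<noteq> 1" by transfer (metis zero_neq_one)
qed

end

text \<open>The smallest exponent of a nonzero series; the value at 0 is arbitrary.\<close>

definition gps_ord :: "gps \<Rightarrow> real" where
  "gps_ord f = (LEAST a. coeff f a \<noteq> 0)"

lemma gps_ord:
  assumes "f \<noteq> 0"
  shows "coeff f (gps_ord f) \<noteq> 0" and "coeff f a \<noteq> 0 \<Longrightarrow> gps_ord f \<le> a"
proof -
  have "\<exists>a. coeff f a \<noteq> 0"
  proof (rule ccontr)
    assume "\<not> (\<exists>a. coeff f a \<noteq> 0)"
    then have "f = 0" by (intro gps_eqI) (simp add: zero_gps.rep_eq)
    then show False using assms by simp
  qed
  then have "{a. coeff f a \<noteq> 0} \<noteq> {}" by blast
  then obtain m where m: "coeff f m \<noteq> 0" "\<And>x. coeff f x \<noteq> 0 \<Longrightarrow> m \<le> x"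
    using well_ordered_supp[of f, unfolded well_ordered_def, rule_format, OF order_refl] by auto
  then have "gps_ord f = m" unfolding gps_ord_def by (intro Least_equality)
  then show "coeff f (gps_ord f) \<noteq> 0" "coeff f a \<noteq> 0 \<Longrightarrow> gps_ord f \<le> a" using m by auto
qed

lift_definition gps_monom :: "complex \<Rightarrow> real \<Rightarrow> gps" is "\<lambda>c e a. if a = e then c else 0"
  by (auto simp: well_ordered_def)

lemma coeff_monom_times: "coeff (gps_monom c e * f) a = c * coeff f (a - e)"
proof -
  have "coeff (gps_monom c e * f) a = (\<Sum>x\<in>{e}. coeff (gps_monom c e) x * coeff f (a - x))"
    by (rule coeff_times) (auto simp: gps_monom.rep_eq split: if_splits)
  then show ?thesis by (simp add: gps_monom.rep_eq)
qed

lemma coeff_power_nonzero: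
  assumes "\<And>a. coeff h a \<noteq> 0 \<Longrightarrow> e \<le> a" "coeff (h ^ n) a \<noteq> 0"
  shows "real n * e \<le> a"
  using assms(2)
proof (induction n arbitrary: a)
  case 0
  then show ?case by (simp add: one_gps.rep_eq split: if_splits)
next
  case (Suc n)
  then obtain b where "coeff h b \<noteq> 0" "coeff (h ^ n) (a - b) \<noteq> 0"
    by (auto elim: coeff_times_nonzeroE)
  then have "e \<le> b" "real n * e \<le> a - b" using assms(1) Suc.IH by auto
  then show ?case by (simp add: algebra_simps)
qed

lemma coeff_sum: "coeff (\<Sum>i\<in>I. f i) a = (\<Sum>i\<in>I. coeff (f i) a)"
  by (induction I rule: infinite_finite_induct) (auto simp: zero_gps.rep_eq plus_gps.rep_eq)

text \<open>The geometric series converges since the exponents are archimedean.\<close>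

lemma gps_one_minus_inverse:
  assumes h: "\<And>a. coeff h a \<noteq> 0 \<Longrightarrow> e \<le> a" and e: "e > 0"
  shows "\<exists>g. (1 - h) * g = 1"
proof -
  define S where "S = (\<lambda>N. \<Sum>n<N. h ^ n)"
  define N where "N = (\<lambda>x. Suc (nat \<lceil>x / e\<rceil>))"
  have N: "x < real (N x) * e" for x
  proof -
    have "x / e < real (N x)" unfolding N_def by linarith
    then show ?thesis using e by (simp add: field_simps)
  qed
  have zero: "coeff (h ^ n) x = 0" if "n \<ge> N x" for n x
  proof (rule ccontr)
    assume "coeff (h ^ n) x \<noteq> 0"
    with h have "real n * e \<le> x" by (rule coeff_power_nonzero)
    moreover have "real (N x) * e \<le> real n * e" using that e by simp
    ultimately show False using N[of x] by linarith
  qed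
  have mono: "N x \<le> N y" if "x \<le> y" for x y
  proof -
    have "x / e \<le> y / e" using that e by (simp add: divide_right_mono)
    then show ?thesis unfolding N_def by (intro Suc_le_mono[THEN iffD2] nat_mono ceiling_mono)
  qed
  have stable: "coeff (S M) x = coeff (S (N x)) x" if "M \<ge> N x" for M x
    unfolding S_def coeff_sum using that zero by (intro sum.mono_neutral_right) auto
  define G where "G = (\<lambda>x. coeff (S (N x)) x)"
  have "well_ordered {x. G x \<noteq> 0}"
    unfolding well_ordered_def
  proof (intro allI impI)
    fix T assume T: "T \<subseteq> {x. G x \<noteq> 0}" "T \<noteq> {}"
    then obtain t where t: "t \<in> T" by auto
    have "T \<inter> {..t} \<subseteq> {x. coeff (S (N t)) x \<noteq> 0}"
    proof
      fix x assume x: "x \<in> T \<inter> {..t}"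
      then have "coeff (S (N t)) x = G x" using stable[OF mono[of x t]] by (simp add: G_def)
      then show "x \<in> {x. coeff (S (N t)) x \<noteq> 0}" using x T(1) by auto
    qed
    moreover have "T \<inter> {..t} \<noteq> {}" using t by auto
    ultimately obtain m where m: "m \<in> T \<inter> {..t}" "\<forall>x\<in>T \<inter> {..t}. m \<le> x"
      using well_ordered_supp[of "S (N t)"] unfolding well_ordered_def by meson
    then show "\<exists>m\<in>T. \<forall>x\<in>T. m \<le> x"
      by (intro bexI[of _ m]) force+
  qed
  then have G: "coeff (Abs_gps G) = G" by (simp add: Abs_gps_inverse)
  have "(1 - h) * Abs_gps G = 1"
  proof (rule gps_eqI)
    fix x
    have nonneg: "0 \<le> a" if "coeff (1 - h) a \<noteq> 0" for a
      using that h[of a] e by (cases "a = 0") (auto simp: minus_gps.rep_eq one_gps.rep_eq)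
    have eq: "G (x - a) = coeff (S (N x)) (x - a)" if "coeff (1 - h) a \<noteq> 0" for a
      using stable[of "x - a" "N x"] mono[of "x - a" x] nonneg[OF that] by (simp add: G_def)
    have "coeff ((1 - h) * Abs_gps G) x = coeff ((1 - h) * S (N x)) x"
      unfolding times_gps.rep_eq G using eq by (intro sum.cong) auto
    also have "(1 - h) * S (N x) = 1 - h ^ N x"
      unfolding S_def by (simp add: one_diff_power_eq)
    also have "coeff (1 - h ^ N x) x = coeff 1 x" using zero[of x "N x"] by (simp add: minus_gps.rep_eq)
    finally show "coeff ((1 - h) * Abs_gps G) x = coeff 1 x" .
  qed
  then show ?thesis by blast
qed

lemma gps_inverse_exists:
  assumes "f \<noteq> (0 :: gps)"
  shows "\<exists>g. f * g = 1"
proof -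
  define c where "c = coeff f (gps_ord f)"
  define u where "u = gps_monom (1 / c) (- gps_ord f)"
  have c: "c \<noteq> 0" using gps_ord(1)[OF assms] by (simp add: c_def)
  define h where "h = 1 - u * f"
  have h: "coeff h a \<noteq> 0 \<Longrightarrow> 0 < a" for a
  proof -
    assume a: "coeff h a \<noteq> 0"
    have eq: "coeff h a = (if a = 0 then 1 else 0) - 1 / c * coeff f (a + gps_ord f)"
      by (simp add: h_def u_def minus_gps.rep_eq one_gps.rep_eq coeff_monom_times)
    have "a \<noteq> 0" using a eq c by (auto simp: c_def)
    then have "coeff f (a + gps_ord f) \<noteq> 0" using a eq by auto
    then have "gps_ord f \<le> a + gps_ord f" by (rule gps_ord(2)[OF assms])
    then show "0 < a" using \<open>a \<noteq> 0\<close> by simp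
  qed
  have "\<exists>e>0. \<forall>a. coeff h a \<noteq> 0 \<longrightarrow> e \<le> a"
  proof (cases "h = 0")
    case True
    then show ?thesis by (intro exI[of _ 1]) (simp add: zero_gps.rep_eq)
  next
    case False
    then show ?thesis using gps_ord[OF False] h by (intro exI[of _ "gps_ord h"]) auto
  qed
  then obtain g where "(1 - h) * g = 1" using gps_one_minus_inverse by blast
  then have "f * (u * g) = 1" by (simp add: h_def mult_ac)
  then show ?thesis by blast
qed

instantiation gps :: field
begin

definition inverse_gps :: "gps \<Rightarrow> gps" where
  "inverse (f :: gps) = (if f = 0 then 0 else (SOME g. f * g = 1))"

definition divide_gps :: "gps \<Rightarrow> gps \<Rightarrow> gps" where
  "f div g = f * inverse (g :: gps)"

instance
proof
  fix f g :: gps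
  show "f \<noteq> 0 \<Longrightarrow> inverse f * f = 1"
    using someI_ex[OF gps_inverse_exists[of f]] by (simp add: inverse_gps_def mult.commute)
  show "f div g = f * inverse g" by (rule divide_gps_def)
  show "inverse (0 :: gps) = 0" by (simp add: inverse_gps_def)
qed

end

text \<open>An \<open>r \<times> r\<close> matrix is a function restricted to indices below \<open>r\<close>.\<close>

definition tropical_det :: "nat \<Rightarrow> (nat \<Rightarrow> nat \<Rightarrow> real) \<Rightarrow> real" where
  "tropical_det r B = Min ((\<lambda>\<sigma>. \<Sum>i<r. B i (\<sigma> i)) ` {\<sigma>. \<sigma> permutes {..<r}})"

definition tropically_singular :: "nat \<Rightarrow> (nat \<Rightarrow> nat \<Rightarrow> real) \<Rightarrow> bool" where
  "tropically_singular r B \<longleftrightarrow>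
    (\<exists>\<sigma> \<tau>. \<sigma> permutes {..<r} \<and> \<tau> permutes {..<r} \<and> \<sigma> \<noteq> \<tau> \<and>
      (\<Sum>i<r. B i (\<sigma> i)) = tropical_det r B \<and> (\<Sum>i<r. B i (\<tau> i)) = tropical_det r B)"

text \<open>
  The injections \<open>\<rho>\<close> and \<open>\<gamma>\<close> list the chosen rows and columns. The order in which they are
  listed is left free, since the index types carry no order and singularity does not depend on it.
\<close>

definition has_nonsingular_submatrix :: "nat \<Rightarrow> real ^ 'n ^ 'm \<Rightarrow> bool" where
  "has_nonsingular_submatrix r M \<longleftrightarrow>
    (\<exists>(\<rho> :: nat \<Rightarrow> 'm) (\<gamma> :: nat \<Rightarrow> 'n). inj_on \<rho> {..<r} \<and> inj_on \<gamma> {..<r} \<and>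
      \<not> tropically_singular r (\<lambda>i j. M $ \<rho> i $ \<gamma> j))"

definition tropical_rank :: "real ^ 'n ^ 'm \<Rightarrow> nat" where
  "tropical_rank M = (GREATEST r. has_nonsingular_submatrix r M)"

lemma has_nonsingular_submatrix_le:
  fixes M :: "real ^ 'n ^ 'm"
  assumes "has_nonsingular_submatrix r M"
  shows "r \<le> CARD('m)" and "r \<le> CARD('n)"
proof -
  obtain \<rho> :: "nat \<Rightarrow> 'm" and \<gamma> :: "nat \<Rightarrow> 'n" where "inj_on \<rho> {..<r}" "inj_on \<gamma> {..<r}"
    using assms unfolding has_nonsingular_submatrix_def by blast
  then show "r \<le> CARD('m)" "r \<le> CARD('n)"
    using card_inj_on_le[of \<rho> "{..<r}" UNIV] card_inj_on_le[of \<gamma> "{..<r}" UNIV] by auto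
qed

lemma has_nonsingular_submatrix_1: "has_nonsingular_submatrix 1 M"
proof -
  have "{..<Suc 0} = {0 :: nat}" by auto
  then have "\<not> tropically_singular 1 B" for B
    by (simp add: tropically_singular_def)
  then show ?thesis by (auto simp: has_nonsingular_submatrix_def inj_on_def)
qed

lemma tropical_rank:
  fixes M :: "real ^ 'n ^ 'm"
  shows "has_nonsingular_submatrix (tropical_rank M) M"
    and "has_nonsingular_submatrix r M \<Longrightarrow> r \<le> tropical_rank M"
proof -
  have bound: "k \<le> CARD('m)" if "has_nonsingular_submatrix k M" for k
    by (rule has_nonsingular_submatrix_le(1)[OF that])
  show "has_nonsingular_submatrix (tropical_rank M) M"
    unfolding tropical_rank_def
    by (rule GreatestI_nat[where P = "\<lambda>r. has_nonsingular_submatrix r M", OF has_nonsingular_submatrix_1 bound])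
  show "r \<le> tropical_rank M" if "has_nonsingular_submatrix r M"
    unfolding tropical_rank_def
    by (rule Greatest_le_nat[where P = "\<lambda>r. has_nonsingular_submatrix r M", OF that bound])
qed

definition tropical_linear_space :: "nat \<Rightarrow> (real ^ 'm) set \<Rightarrow> bool" where
  "tropical_linear_space r T \<longleftrightarrow>
    (\<exists>V :: (gps ^ 'm) set. vec.subspace V \<and> vec.dim V = r \<and>
      T = (\<lambda>v. \<chi> i. gps_ord (v $ i)) ` {v \<in> V. \<forall>i. v $ i \<noteq> 0})"

definition kapranov_rank :: "real ^ 'n ^ 'm \<Rightarrow> nat" where
  "kapranov_rank M = (LEAST r. \<exists>T. tropical_linear_space r T \<and> columns M \<subseteq> T)"

lemma gps_ord_monom: "c \<noteq> 0 \<Longrightarrow> gps_ord (gps_monom c e) = e"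
  unfolding gps_ord_def by (rule Least_equality) (auto simp: gps_monom.rep_eq split: if_splits)

lemma gps_monom_nonzero: "c \<noteq> 0 \<Longrightarrow> gps_monom c e \<noteq> 0"
  by (metis gps_monom.rep_eq zero_gps.rep_eq)

lemma tropical_linear_space_UNIV: "tropical_linear_space CARD('m) (UNIV :: (real ^ 'm) set)"
  unfolding tropical_linear_space_def
proof (intro exI[of _ UNIV] conjI)
  show "vec.dim (UNIV :: (gps ^ 'm) set) = CARD('m)" by (rule vec_dim_card)
  show "(UNIV :: (real ^ 'm) set) = (\<lambda>v. \<chi> i. gps_ord (v $ i)) ` {v \<in> UNIV. \<forall>i. v $ i \<noteq> 0}"
  proof (intro equalityI subsetI)
    fix x :: "real ^ 'm"
    show "x \<in> (\<lambda>v. \<chi> i. gps_ord (v $ i)) ` {v \<in> UNIV. \<forall>i. v $ i \<noteq> 0}"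
      by (rule image_eqI[of _ _ "\<chi> i. gps_monom 1 (x $ i)"])
        (auto simp: gps_ord_monom gps_monom_nonzero vec_eq_iff)
  qed auto
qed simp

lemma kapranov_rank_attained:
  "\<exists>T. tropical_linear_space (kapranov_rank M) T \<and> columns M \<subseteq> T"
  unfolding kapranov_rank_def
  by (rule LeastI_ex) (use tropical_linear_space_UNIV in blast)

end

theory Submission
  imports Defs "Jordan_Normal_Form.Determinant"
begin

text \<open>
  Write \<open>A\<close> by its rows \<open>a\<close>, which are points of \<open>\<real>\<^sup>5\<close>. Since no \<open>4 \<times> 4\<close> submatrix is
  nonsingular, Brouwer's theorem gives for each column \<open>j\<close> a vector \<open>w j\<close>, defined on the other four
  columns, such that for every row \<open>a\<close> the minimum of \<open>w j + a\<close> is attained at least twice. A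
  row lies in the stable intersection of the hyperplanes of \<open>w i\<close> and \<open>w j\<close> unless both minima are
  attained exactly on the same two columns. If every pair \<open>{i, j}\<close> had such a bad row, with columns
  \<open>f {i, j}\<close>, then for fixed \<open>i\<close> counting would give \<open>j\<close> and \<open>k\<close> with \<open>k \<in> f {i, j}\<close> and
  \<open>j \<in> f {i, k}\<close>, and the bad rows of the pairs in \<open>{i, j, k}\<close> satisfy contradictory linear
  inequalities. So all rows lie in one stable intersection, where they lift to the common kernel of
  two linear forms over the field of power series.
\<close>

no_notation Matrix.vec_index (infixl "$" 100)

section \<open>Minimisers of tropical linear forms\<close>

text \<open>With \<open>f l = w l + a l\<close>, the point \<open>a\<close> lies on the tropical
  hyperplane of \<open>w\<close> on the coordinates \<open>K\<close> exactly when this set has at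
  least two elements. Coordinates outside \<open>K\<close> play the part of infinite
  coefficients.\<close>

definition argmins :: "('a \<Rightarrow> real) \<Rightarrow> 'a set \<Rightarrow> 'a set" where
  "argmins f K = {k \<in> K. \<forall>l\<in>K. f k \<le> f l}"

lemma argmins_subset: "argmins f K \<subseteq> K"
  by (auto simp: argmins_def)

lemma argmins_nonempty: "finite K \<Longrightarrow> K \<noteq> {} \<Longrightarrow> argmins f K \<noteq> {}"
  using ex_min_if_finite[of "f ` K"] by (fastforce simp: argmins_def not_less)

lemma argmins_less: "k \<in> argmins f K \<Longrightarrow> l \<in> K \<Longrightarrow> l \<notin> argmins f K \<Longrightarrow> f k < f l"
  unfolding argmins_def by (smt (verit, best) mem_Collect_eq)

lemma argmins_eq_value: "k \<in> argmins f K \<Longrightarrow> l \<in> argmins f K \<Longrightarrow> f k = f l"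
  unfolding argmins_def by (simp add: antisym)

lemma two_le_cardE:
  assumes "2 \<le> card S"
  obtains x y where "x \<in> S" "y \<in> S" "x \<noteq> y"
proof -
  have "\<exists>T\<subseteq>S. card T = 2" using assms by (metis obtain_subset_with_card_n)
  then show thesis using that by (metis card_2_iff insertCI subsetD)
qed

lemma argmins_pair_less:
  assumes "argmins f (UNIV - {i}) = {a, b}" "UNIV = {i, a, b, c, d}" "distinct [i, a, b, c, d]"
  shows "f a = f b \<and> f a < f c \<and> f a < f d"
  using argmins_eq_value[of a f "UNIV - {i}" b] argmins_less[of a f "UNIV - {i}" c]
    argmins_less[of a f "UNIV - {i}" d] assms by auto

lemma argmins_twice:
  assumes "2 \<le> card (argmins f K)" "k \<in> K"
  shows "\<exists>l\<in>K - {k}. f l \<le> f k"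
proof -
  obtain x y where "x \<in> argmins f K" "y \<in> argmins f K" "x \<noteq> y"
    using two_le_cardE[OF assms(1)] by metis
  then obtain z where z: "z \<in> argmins f K" "z \<noteq> k" by metis
  then have "f z \<le> f k" "z \<in> K" using assms(2) by (auto simp: argmins_def)
  then show ?thesis using z by blast
qed

text \<open>Turns a minimum attained twice on the four columns other than \<open>i\<close> into a
  disjunction of linear inequalities, the form in which linear arithmetic can use it.\<close>

lemma not_strict_min_of_four:
  assumes "2 \<le> card (argmins f (UNIV - {i}))" "UNIV = {i, a, b, c, d}" "a \<noteq> i"
  shows "f b \<le> f a \<or> f c \<le> f a \<or> f d \<le> f a"
proof -
  have "a \<in> UNIV - {i}" using assms(3) by simp
  then obtain l where l: "l \<noteq> i" "l \<noteq> a" "f l \<le> f a" using argmins_twice[OF assms(1)] by blast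
  have "l \<in> {i, a, b, c, d}" unfolding assms(2)[symmetric] by simp
  then show ?thesis using l by blast
qed

subsection \<open>Bad rows of three columns\<close>

text \<open>
  The vector \<open>w u\<close> lives on the columns other than \<open>u\<close>; the value \<open>w u u\<close> is junk. The bad rows
  \<open>a\<close> and \<open>b\<close> force opposite strict inequalities between coordinate differences of \<open>w j\<close> and
  \<open>w k\<close>, except for \<open>P = {i, m}\<close>, where a minimum of \<open>a\<close> would be attained only once.
\<close>

lemma triple_conflict_same:
  fixes w :: "'n \<Rightarrow> 'n \<Rightarrow> real"
  assumes U: "UNIV = {i, j, k, m, n}" and d: "distinct [i, j, k, m, n]"
    and tw: "\<And>u. 2 \<le> card (argmins (\<lambda>l. w u l + a l) (UNIV - {u}))"
      "\<And>u. 2 \<le> card (argmins (\<lambda>l. w u l + b l) (UNIV - {u}))"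
      "\<And>u. 2 \<le> card (argmins (\<lambda>l. w u l + c l) (UNIV - {u}))"
    and a: "argmins (\<lambda>l. w i l + a l) (UNIV - {i}) = {k, m}" "argmins (\<lambda>l. w j l + a l) (UNIV - {j}) = {k, m}"
    and b: "argmins (\<lambda>l. w i l + b l) (UNIV - {i}) = {j, m}" "argmins (\<lambda>l. w k l + b l) (UNIV - {k}) = {j, m}"
    and c: "argmins (\<lambda>l. w j l + c l) (UNIV - {j}) = P" "argmins (\<lambda>l. w k l + c l) (UNIV - {k}) = P"
    and P: "P = {m, n} \<or> P = {i, m} \<or> P = {i, n}"
  shows False
proof -
  have perm: "UNIV = {i, k, m, j, n}" "UNIV = {i, j, m, k, n}" "UNIV = {j, k, m, i, n}" "UNIV = {k, j, m, i, n}"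
    "UNIV = {j, m, i, k, n}" "UNIV = {k, m, i, j, n}" "UNIV = {i, m, j, k, n}"
    unfolding U by auto
  have ai: "w i k + a k = w i m + a m" "w i k + a k < w i j + a j" "w i k + a k < w i n + a n"
    using argmins_pair_less[OF a(1) perm(1)] d by auto
  have aj: "w j k + a k = w j m + a m" "w j k + a k < w j i + a i" "w j k + a k < w j n + a n"
    using argmins_pair_less[OF a(2) perm(3)] d by auto
  have bi: "w i j + b j = w i m + b m" "w i j + b j < w i k + b k" "w i j + b j < w i n + b n"
    using argmins_pair_less[OF b(1) perm(2)] d by auto
  have bk: "w k j + b j = w k m + b m" "w k j + b j < w k i + b i" "w k j + b j < w k n + b n"
    using argmins_pair_less[OF b(2) perm(4)] d by auto
  \<comment> \<open>Column \<open>j\<close> is ruled out as a rival of \<open>m\<close>: row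
    \<open>b\<close> gives \<open>w k\<close> and \<open>w i\<close> the same difference between
    \<open>j\<close> and \<open>m\<close>, and on \<open>w i\<close> row \<open>a\<close> is
    strictly larger at \<open>j\<close>. In \<open>bj\<close> the roles of \<open>a\<close> and
    \<open>b\<close>, and of \<open>j\<close> and \<open>k\<close>, are exchanged.\<close>
  have ak: "w k i + a i \<le> w k m + a m \<or> w k n + a n \<le> w k m + a m"
    using not_strict_min_of_four[OF tw(1)[of k] perm(6)] d ai bk bi by auto
  have bj: "w j i + b i \<le> w j m + b m \<or> w j n + b n \<le> w j m + b m"
    using not_strict_min_of_four[OF tw(2)[of j] perm(5)] d bk bi ai aj by auto
  show False using P
  proof (elim disjE)
    \<comment> \<open>Row \<open>c\<close> gives \<open>w j\<close> and \<open>w k\<close> the same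
      difference between \<open>m\<close> and \<open>n\<close>. This removes the alternatives with
      \<open>n\<close> from \<open>ak\<close> and \<open>bj\<close>, and the remaining ones compare
      \<open>w j i - w j m\<close> with \<open>w k i - w k m\<close> in opposite strict
      directions.\<close>
    assume e: "P = {m, n}"
    have p: "UNIV = {j, m, n, i, k}" "UNIV = {k, m, n, i, j}" unfolding U by auto
    have "w j m + c m = w j n + c n" using argmins_pair_less[OF c(1)[unfolded e] p(1)] d by auto
    moreover have "w k m + c m = w k n + c n" using argmins_pair_less[OF c(2)[unfolded e] p(2)] d by auto
    ultimately show False using ak bj aj bk by linarith
  next
    assume e: "P = {i, m}"
    have p: "UNIV = {j, i, m, k, n}" "UNIV = {k, i, m, j, n}" unfolding U by auto
    have "w j i + c i = w j m + c m" "w j i + c i < w j k + c k" "w j i + c i < w j n + c n"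
      using argmins_pair_less[OF c(1)[unfolded e] p(1)] d by auto
    moreover have "w k i + c i = w k m + c m" "w k i + c i < w k j + c j" "w k i + c i < w k n + c n"
      using argmins_pair_less[OF c(2)[unfolded e] p(2)] d by auto
    moreover have "w i j + c j \<le> w i m + c m \<or> w i k + c k \<le> w i m + c m \<or> w i n + c n \<le> w i m + c m"
      using not_strict_min_of_four[OF tw(3)[of i] perm(7)] d by auto
    ultimately show False using ak ai aj bi bk by linarith
  next
    \<comment> \<open>Now the differences between \<open>i\<close> and \<open>n\<close> agree in
      \<open>w j\<close> and \<open>w k\<close>, so both alternatives of \<open>ak\<close> yield the
      same strict inequality, and both alternatives of \<open>bj\<close> its reverse.\<close>
    assume e: "P = {i, n}"
    have p: "UNIV = {j, i, n, k, m}" "UNIV = {k, i, n, j, m}" unfolding U by auto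
    have "w j i + c i = w j n + c n" using argmins_pair_less[OF c(1)[unfolded e] p(1)] d by auto
    moreover have "w k i + c i = w k n + c n" using argmins_pair_less[OF c(2)[unfolded e] p(2)] d by auto
    ultimately show False using ak bj aj bk by linarith
  qed
qed

text \<open>Here the pairs of \<open>a\<close> and \<open>b\<close> share no column. Row
  \<open>c\<close> turns out to attain equal values at \<open>m\<close> and \<open>n\<close> on
  \<open>w i\<close> as well, so the difference between \<open>m\<close> and \<open>n\<close> is the
  same in \<open>w i\<close>, \<open>w j\<close> and \<open>w k\<close>. Modulo this identification,
  \<open>a\<close> and \<open>b\<close> again force opposite strict inequalities between
  \<open>w j\<close> and \<open>w k\<close>.\<close>

lemma triple_conflict_cross:
  fixes w :: "'n \<Rightarrow> 'n \<Rightarrow> real"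
  assumes U: "UNIV = {i, j, k, m, n}" and d: "distinct [i, j, k, m, n]"
    and tw: "\<And>u. 2 \<le> card (argmins (\<lambda>l. w u l + a l) (UNIV - {u}))"
      "\<And>u. 2 \<le> card (argmins (\<lambda>l. w u l + b l) (UNIV - {u}))"
      "\<And>u. 2 \<le> card (argmins (\<lambda>l. w u l + c l) (UNIV - {u}))"
    and a: "argmins (\<lambda>l. w i l + a l) (UNIV - {i}) = {k, m}" "argmins (\<lambda>l. w j l + a l) (UNIV - {j}) = {k, m}"
    and b: "argmins (\<lambda>l. w i l + b l) (UNIV - {i}) = {j, n}" "argmins (\<lambda>l. w k l + b l) (UNIV - {k}) = {j, n}"
    and c: "argmins (\<lambda>l. w j l + c l) (UNIV - {j}) = {m, n}" "argmins (\<lambda>l. w k l + c l) (UNIV - {k}) = {m, n}"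
  shows False
proof -
  have perm: "UNIV = {i, k, m, j, n}" "UNIV = {i, j, n, k, m}" "UNIV = {j, k, m, i, n}" "UNIV = {k, j, n, i, m}"
    "UNIV = {j, m, n, i, k}" "UNIV = {k, m, n, i, j}" "UNIV = {k, m, i, j, n}" "UNIV = {j, n, i, k, m}"
    "UNIV = {i, m, j, k, n}" "UNIV = {i, n, j, k, m}"
    unfolding U by auto
  have ai: "w i k + a k = w i m + a m" "w i k + a k < w i j + a j" "w i k + a k < w i n + a n"
    using argmins_pair_less[OF a(1) perm(1)] d by auto
  have aj: "w j k + a k = w j m + a m" "w j k + a k < w j i + a i" "w j k + a k < w j n + a n"
    using argmins_pair_less[OF a(2) perm(3)] d by auto
  have bi: "w i j + b j = w i n + b n" "w i j + b j < w i k + b k" "w i j + b j < w i m + b m"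
    using argmins_pair_less[OF b(1) perm(2)] d by auto
  have bk: "w k j + b j = w k n + b n" "w k j + b j < w k i + b i" "w k j + b j < w k m + b m"
    using argmins_pair_less[OF b(2) perm(4)] d by auto
  have cj: "w j m + c m = w j n + c n" "w j m + c m < w j i + c i" "w j m + c m < w j k + c k"
    using argmins_pair_less[OF c(1) perm(5)] d by auto
  have ck: "w k m + c m = w k n + c n" "w k m + c m < w k i + c i" "w k m + c m < w k j + c j"
    using argmins_pair_less[OF c(2) perm(6)] d by auto
  \<comment> \<open>On \<open>w i\<close>, row \<open>c\<close> is larger at \<open>k\<close> than
    at \<open>m\<close>, since \<open>a\<close> gives \<open>w i\<close> and \<open>w j\<close> the
    same difference between \<open>k\<close> and \<open>m\<close>. It is larger at \<open>j\<close>
    than at \<open>n\<close>, since \<open>b\<close> gives \<open>w i\<close> and \<open>w k\<close>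
    the same difference between \<open>j\<close> and \<open>n\<close>.\<close>
  have "w i n + c n \<le> w i m + c m"
    using not_strict_min_of_four[OF tw(3)[of i] perm(9)] d ai aj bi bk cj ck by force
  moreover have "w i m + c m \<le> w i n + c n"
    using not_strict_min_of_four[OF tw(3)[of i] perm(10)] d ai aj bi bk cj ck by force
  ultimately have ci: "w i m + c m = w i n + c n" by simp
  have ak: "w k i + a i \<le> w k m + a m"
    using not_strict_min_of_four[OF tw(1)[of k] perm(7)] d ai aj bi bk cj ck ci by force
  have bj: "w j i + b i \<le> w j n + b n"
    using not_strict_min_of_four[OF tw(2)[of j] perm(8)] d ai aj bi bk cj ck ci by force
  show False using ak bj aj bk cj ck by linarith
qed

text \<open>Up to exchanging \<open>m\<close> and \<open>n\<close>, either \<open>P\<close> and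
  \<open>Q\<close> share their second column, or they do not. In the latter case \<open>R\<close> is
  \<open>{m, n}\<close>, the crossed configuration, or it contains \<open>i\<close> and shares a
  second column with \<open>P\<close> or \<open>Q\<close>. The last case is the shared configuration
  again, with \<open>j\<close> or \<open>k\<close> in the role of \<open>i\<close>.\<close>

lemma triple_conflict:
  fixes w :: "'n \<Rightarrow> 'n \<Rightarrow> real"
  assumes U: "UNIV = {i, j, k, m, n}" and d: "distinct [i, j, k, m, n]"
    and tw: "\<And>u. 2 \<le> card (argmins (\<lambda>l. w u l + a l) (UNIV - {u}))"
      "\<And>u. 2 \<le> card (argmins (\<lambda>l. w u l + b l) (UNIV - {u}))"
      "\<And>u. 2 \<le> card (argmins (\<lambda>l. w u l + c l) (UNIV - {u}))"
    and a: "argmins (\<lambda>l. w i l + a l) (UNIV - {i}) = P" "argmins (\<lambda>l. w j l + a l) (UNIV - {j}) = P"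
    and b: "argmins (\<lambda>l. w i l + b l) (UNIV - {i}) = Q" "argmins (\<lambda>l. w k l + b l) (UNIV - {k}) = Q"
    and c: "argmins (\<lambda>l. w j l + c l) (UNIV - {j}) = R" "argmins (\<lambda>l. w k l + c l) (UNIV - {k}) = R"
    and card: "card P = 2" "card Q = 2" "card R = 2"
    and k: "k \<in> P" and j: "j \<in> Q"
  shows False
proof -
  have dis: "i \<noteq> j" "i \<noteq> k" "i \<noteq> m" "i \<noteq> n" "j \<noteq> k" "j \<noteq> m" "j \<noteq> n" "k \<noteq> m" "k \<noteq> n" "m \<noteq> n" using d by auto
  have perm: "UNIV = {i, j, k, n, m}" "UNIV = {j, i, k, m, n}" "UNIV = {j, i, k, n, m}"
    "UNIV = {k, i, j, m, n}" "UNIV = {k, i, j, n, m}"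
    unfolding U by auto
  have distinct: "distinct [i, j, k, n, m]" "distinct [j, i, k, m, n]" "distinct [j, i, k, n, m]"
    "distinct [k, i, j, m, n]" "distinct [k, i, j, n, m]"
    using d by auto
  have sub: "P \<subseteq> {k, m, n}" "Q \<subseteq> {j, m, n}" "R \<subseteq> {i, m, n}"
  proof -
    have "P \<subseteq> (UNIV - {i}) \<inter> (UNIV - {j})"
      using argmins_subset[of _ "UNIV - {i}", unfolded a(1)] by (metis Int_greatest a argmins_subset)
    then show "P \<subseteq> {k, m, n}" unfolding U using dis by auto
    have "Q \<subseteq> (UNIV - {i}) \<inter> (UNIV - {k})"
      using argmins_subset[of _ "UNIV - {i}", unfolded b(1)] by (metis Int_greatest b argmins_subset)
    then show "Q \<subseteq> {j, m, n}" unfolding U using dis by auto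
    have "R \<subseteq> (UNIV - {j}) \<inter> (UNIV - {k})"
      using argmins_subset[of _ "UNIV - {j}", unfolded c(1)] by (metis Int_greatest c argmins_subset)
    then show "R \<subseteq> {i, m, n}" unfolding U using dis by auto
  qed
  have P: "P = {k, m} \<or> P = {k, n}"
  proof -
    obtain x where "P = {k, x}" "x \<noteq> k" using card(1) k by (metis card_2_iff doubleton_eq_iff insertE singletonD)
    then show ?thesis using sub by auto
  qed
  have Q: "Q = {j, m} \<or> Q = {j, n}"
  proof -
    obtain x where "Q = {j, x}" "x \<noteq> j" using card(2) j by (metis card_2_iff doubleton_eq_iff insertE singletonD)
    then show ?thesis using sub by auto
  qed
  have R: "R = {m, n} \<or> R = {i, m} \<or> R = {i, n}"
  proof -
    obtain x y where "R = {x, y}" "x \<noteq> y" using card(3) by (metis card_2_iff)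
    then show ?thesis using sub by (auto simp: insert_commute)
  qed
  show False
    using P
  proof
    assume P: "P = {k, m}"
    show False
      using Q
    proof
      assume Q: "Q = {j, m}"
      show False by (rule triple_conflict_same[OF U d tw a[unfolded P] b[unfolded Q] c R])
    next
      assume Q: "Q = {j, n}"
      show False
        using R
      proof (elim disjE)
        assume R: "R = {m, n}"
        show False by (rule triple_conflict_cross[OF U d tw a[unfolded P] b[unfolded Q] c[unfolded R]])
      next
        assume R: "R = {i, m}"
        show False
          \<comment> \<open>Column \<open>j\<close> takes the role of \<open>i\<close>: the rows
            \<open>a\<close> and \<open>c\<close> of the pairs containing \<open>j\<close> share
            \<open>m\<close>, and row \<open>b\<close> is the third one.\<close>
          by (rule triple_conflict_same[OF perm(2) distinct(2) tw(1,3,2) a(2,1)[unfolded P] c[unfolded R] b])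
            (simp add: Q)
      next
        assume R: "R = {i, n}"
        show False
          by (rule triple_conflict_same[OF perm(5) distinct(5) tw(2,3,1) b(2,1)[unfolded Q] c(2,1)[unfolded R] a])
            (simp add: P)
      qed
    qed
  next
    assume P: "P = {k, n}"
    show False
      using Q
    proof
      assume Q: "Q = {j, n}"
      show False
        by (rule triple_conflict_same[OF perm(1) distinct(1) tw a[unfolded P] b[unfolded Q] c])
          (use R in \<open>auto simp: insert_commute\<close>)
    next
      assume Q: "Q = {j, m}"
      show False
        using R
      proof (elim disjE)
        assume R: "R = {m, n}"
        show False
          by (rule triple_conflict_cross[OF perm(1) distinct(1) tw a[unfolded P] b[unfolded Q]])
            (use R c in \<open>auto simp: insert_commute\<close>)
      next
        assume R: "R = {i, n}"
        show False
          by (rule triple_conflict_same[OF perm(3) distinct(3) tw(1,3,2) a(2,1)[unfolded P] c[unfolded R] b])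
            (simp add: Q)
      next
        assume R: "R = {i, m}"
        show False
          by (rule triple_conflict_same[OF perm(4) distinct(4) tw(2,3,1) b(2,1)[unfolded Q] c(2,1)[unfolded R] a])
            (simp add: P)
      qed
    qed
  qed
qed

section \<open>Two columns without a bad row\<close>

text \<open>Draw an arrow from each \<open>j\<close> to the two elements of \<open>f j\<close>.
  These are eight arrows among the four columns other than \<open>i\<close>, which have only six
  unordered pairs, so some pair is joined in both directions.\<close>

lemma mutual_pair:
  assumes U: "UNIV = {i, p, q, r, s}" and d: "distinct [i, p, q, r, s]"
    and f: "\<And>j. j \<noteq> i \<Longrightarrow> f j \<subseteq> UNIV - {i, j} \<and> card (f j) = 2"
  obtains j k where "j \<noteq> i" "k \<noteq> i" "j \<noteq> k" "k \<in> f j" "j \<in> f k"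
proof -
  have miss: "x \<notin> f j \<Longrightarrow> y \<in> f j"
    if "j \<noteq> i" "x \<noteq> i" "y \<noteq> i" "x \<noteq> j" "y \<noteq> j" "x \<noteq> y" for j x y
  proof (rule ccontr)
    assume "x \<notin> f j" "y \<notin> f j"
    then have "f j \<subseteq> UNIV - {i, j, x, y}" using f that by auto
    then have "card (f j) \<le> card (UNIV - {i, j, x, y})"
      by (rule card_mono[rotated]) (simp add: finite_subset[of _ "UNIV :: 'a set"] U)
    moreover have "card (UNIV - {i, j, x, y}) = card (UNIV :: 'a set) - card {i, j, x, y}"
      by (rule card_Diff_subset) auto
    moreover have "card (UNIV :: 'a set) = 5" "card {i, j, x, y} = 4" using d that unfolding U by auto
    ultimately show False using f[of j] that by auto
  qed
  have dis: "p \<noteq> i" "q \<noteq> i" "r \<noteq> i" "s \<noteq> i" "p \<noteq> q" "p \<noteq> r" "p \<noteq> s" "q \<noteq> r" "q \<noteq> s" "r \<noteq> s"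
    using d by auto
  have "q \<in> f p \<or> r \<in> f p" "q \<in> f p \<or> s \<in> f p" "r \<in> f p \<or> s \<in> f p"
    "p \<in> f q \<or> r \<in> f q" "p \<in> f q \<or> s \<in> f q" "r \<in> f q \<or> s \<in> f q"
    "p \<in> f r \<or> q \<in> f r" "p \<in> f r \<or> s \<in> f r" "q \<in> f r \<or> s \<in> f r"
    "p \<in> f s \<or> q \<in> f s" "p \<in> f s \<or> r \<in> f s" "q \<in> f s \<or> r \<in> f s"
    using miss dis by metis+
  then have "(q \<in> f p \<and> p \<in> f q) \<or> (r \<in> f p \<and> p \<in> f r) \<or> (s \<in> f p \<and> p \<in> f s) \<or>
    (r \<in> f q \<and> q \<in> f r) \<or> (s \<in> f q \<and> q \<in> f s) \<or> (s \<in> f r \<and> r \<in> f s)"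
    by argo
  then show thesis using that dis by metis
qed

lemma stable_pair_exists:
  fixes w :: "'n \<Rightarrow> 'n \<Rightarrow> real" and a :: "'g \<Rightarrow> 'n \<Rightarrow> real"
  assumes five: "card (UNIV :: 'n set) = 5"
    and tw: "\<And>u g. 2 \<le> card (argmins (\<lambda>l. w u l + a g l) (UNIV - {u}))"
  obtains i j where "i \<noteq> j"
    "\<And>g P. argmins (\<lambda>l. w i l + a g l) (UNIV - {i}) = P \<Longrightarrow>
       argmins (\<lambda>l. w j l + a g l) (UNIV - {j}) = P \<Longrightarrow> card P \<noteq> 2"
proof (rule ccontr)
  define T where "T = (\<lambda>u g. argmins (\<lambda>l. w u l + a g l) (UNIV - {u}))"
  assume "\<not> thesis"
  then have "\<forall>i j. i \<noteq> j \<longrightarrow> (\<exists>g. T i g = T j g \<and> card (T j g) = 2)"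
    using that unfolding T_def by metis
  then obtain G where G: "\<And>i j. i \<noteq> j \<Longrightarrow> T i (G i j) = T j (G i j)" "\<And>i j. i \<noteq> j \<Longrightarrow> card (T j (G i j)) = 2"
    by metis
  have fin: "finite (UNIV :: 'n set)" using five card.infinite by fastforce
  then obtain xs :: "'n list" where xs: "set xs = UNIV" "distinct xs" "length xs = 5"
    using finite_distinct_list distinct_card five by metis
  then obtain i p q r s where "xs = [i, p, q, r, s]"
    by (auto simp: numeral_eq_Suc length_Suc_conv)
  then have U: "UNIV = {i, p, q, r, s}" and d: "distinct [i, p, q, r, s]" using xs by auto
  \<comment> \<open>In a bad row the two sets of minimisers coincide, so the common set avoids both
    \<open>i\<close> and \<open>j\<close>.\<close>
  have "T j (G i j) \<subseteq> UNIV - {i, j} \<and> card (T j (G i j)) = 2" if "j \<noteq> i" for j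
  proof -
    have "T j (G i j) \<subseteq> UNIV - {j}" "T i (G i j) \<subseteq> UNIV - {i}"
      unfolding T_def by (rule argmins_subset)+
    then show ?thesis using G[of i j] that by auto
  qed
  then obtain j k where jk: "j \<noteq> i" "k \<noteq> i" "j \<noteq> k" "k \<in> T j (G i j)" "j \<in> T k (G i k)"
    by (rule mutual_pair[where f = "\<lambda>j. T j (G i j)", OF U d])
  have "card (UNIV - {i, j, k}) = 2"
    using jk five by (subst card_Diff_subset) auto
  then obtain m n where mn: "UNIV - {i, j, k} = {m, n}" "m \<noteq> n" by (meson card_2_iff)
  then have U': "UNIV = {i, j, k, m, n}" by auto
  have d': "distinct [i, j, k, m, n]" using jk mn by auto
  show False
    by (rule triple_conflict[OF U' d' tw tw tw G(1)[of i j, unfolded T_def] refl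
          G(1)[of i k, unfolded T_def] refl G(1)[of j k, unfolded T_def] refl, folded T_def])
      (use G jk in \<open>simp_all add: T_def\<close>)
qed

subsection \<open>Hyperplanes through the rows\<close>

lemma continuous_on_Min_image:
  fixes f :: "'i \<Rightarrow> 'a::topological_space \<Rightarrow> 'b::linorder_topology"
  assumes "finite J" "J \<noteq> {}" "\<And>j. j \<in> J \<Longrightarrow> continuous_on S (f j)"
  shows "continuous_on S (\<lambda>x. Min ((\<lambda>j. f j x) ` J))"
  using assms
proof (induction rule: finite_ne_induct)
  case (singleton j)
  then show ?case by simp
next
  case (insert j J)
  then have "continuous_on S (\<lambda>x. min (f j x) (Min ((\<lambda>j. f j x) ` J)))"
    by (intro continuous_on_min) auto
  with insert show ?case by simp
qed

lemma argmins_eq_singletonI: "k \<in> K \<Longrightarrow> (\<And>l. l \<in> K \<Longrightarrow> l \<noteq> k \<Longrightarrow> f k < f l) \<Longrightarrow> argmins f K = {k}"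
  unfolding argmins_def by force

lemma argmins_singletonD: "argmins f K = {k} \<Longrightarrow> l \<in> K \<Longrightarrow> l \<noteq> k \<Longrightarrow> f k < f l"
  using argmins_less[of k f K l] by auto

text \<open>
  Column \<open>k\<close> has positive excess at \<open>w\<close> if some row attains its minimum only at \<open>k\<close>, and raising
  \<open>w $ k\<close> repairs this. At a fixed point of the normalised correction all excesses agree; by
  assumption they are not all positive, so they all vanish.
\<close>

lemma exists_twice_attained:
  fixes a :: "'g::finite \<Rightarrow> 'n::finite \<Rightarrow> real"
  assumes K: "2 \<le> card K"
    and no: "\<not> (\<exists>w. \<forall>k\<in>K. \<exists>g. argmins (\<lambda>l. w l + a g l) K = {k})"
  shows "\<exists>w. \<forall>g. 2 \<le> card (argmins (\<lambda>l. w l + a g l) K)"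
proof -
  \<comment> \<open>\<open>t w k g\<close> is the amount by which \<open>w $ k\<close> must be
    raised until row \<open>g\<close> ties at \<open>k\<close> with another column, and 0 if
    \<open>k\<close> is not the only minimiser. Averaging over the rows gives the excess
    \<open>\<phi>\<close>. The map \<open>G\<close> moves each coordinate by half of its excess
    minus the mean excess, which preserves the coordinate sum.\<close>
  define t where "t = (\<lambda>(w :: real ^ 'n) k g. max 0 (Min ((\<lambda>l. w $ l + a g l - a g k) ` (K - {k})) - w $ k))"
  define \<phi> where "\<phi> = (\<lambda>w k. (\<Sum>g\<in>UNIV. t w k g) / real CARD('g))"
  define G where "G = (\<lambda>w :: real ^ 'n. (\<chi> k. if k \<in> K then w $ k + (\<phi> w k - (\<Sum>l\<in>K. \<phi> w l) / card K) / 2 else 0))"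
  define C where "C = Max (range (\<lambda>(g, l, k). \<bar>a g l - a g k\<bar>))"
  \<comment> \<open>Upper bounds suffice for compactness, because the zero sum turns them into lower
    bounds. The bound \<open>2 * C\<close> is chosen so that the half step in \<open>G\<close>
    respects it.\<close>
  define D where "D = {w :: real ^ 'n. (\<forall>k. k \<notin> K \<longrightarrow> w $ k = 0) \<and> (\<Sum>k\<in>K. w $ k) = 0 \<and> (\<forall>k. w $ k \<le> 2 * C)}"
  have C: "\<bar>a g l - a g k\<bar> \<le> C" for g l k
    unfolding C_def by (rule Max_ge) (auto intro!: image_eqI[of _ _ "(g, l, k)"])
  have C0: "0 \<le> C" using C[of undefined undefined undefined] by simp
  have cardK: "0 < card K" using K by simp
  have ne: "K - {k} \<noteq> {}" for k
  proof
    assume "K - {k} = {}"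
    then have "K \<subseteq> {k}" by auto
    then have "card K \<le> 1" using card_mono[of "{k}" K] by simp
    then show False using K by simp
  qed
  have t_pos: "t w k g > 0 \<longleftrightarrow> (\<forall>l\<in>K - {k}. w $ k + a g k < w $ l + a g l)" for w k g
  proof -
    have "t w k g > 0 \<longleftrightarrow> w $ k < Min ((\<lambda>l. w $ l + a g l - a g k) ` (K - {k}))"
      by (auto simp: t_def)
    also have "\<dots> \<longleftrightarrow> (\<forall>l\<in>K - {k}. w $ k < w $ l + a g l - a g k)"
      using ne[of k] by (subst Min_gr_iff) auto
    finally show ?thesis by (simp add: algebra_simps)
  qed
  have t_nonneg: "0 \<le> t w k g" for w k g by (simp add: t_def)
  then have phi_nonneg: "0 \<le> \<phi> w k" for w k by (simp add: \<phi>_def sum_nonneg)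
  have phi_le: "\<phi> w k \<le> b" if "\<And>g. t w k g \<le> b" for w k b
  proof -
    have "(\<Sum>g\<in>UNIV. t w k g) \<le> real CARD('g) * b" using that by (intro sum_bounded_above) auto
    then show ?thesis by (simp add: \<phi>_def field_simps)
  qed
  \<comment> \<open>If \<open>w $ k \<le> C\<close>, any rival \<open>l\<close> bounds the tie
    threshold by \<open>3 * C\<close>, so the excess is at most
    \<open>3 * C - w $ k \<le> 4 * C - 2 * (w $ k)\<close>. If \<open>w $ k > C\<close>, the zero
    sum supplies a rival with \<open>w $ l \<le> 0\<close>, which beats \<open>k\<close> in every
    row, so the excess is 0.\<close>
  have phi_bound: "w $ k + \<phi> w k / 2 \<le> 2 * C" if "w \<in> D" "k \<in> K" for w k
  proof (cases "w $ k \<le> C")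
    case True
    have "t w k g \<le> 4 * C - 2 * (w $ k)" for g
    proof -
      obtain l where l: "l \<in> K - {k}" using ne by auto
      have "Min ((\<lambda>l. w $ l + a g l - a g k) ` (K - {k})) \<le> w $ l + a g l - a g k"
        using l by (intro Min_le) auto
      moreover have "w $ l \<le> 2 * C" using that by (simp add: D_def)
      ultimately show ?thesis using C[of g l k] True C0 by (auto simp: t_def)
    qed
    then have "\<phi> w k \<le> 4 * C - 2 * (w $ k)" by (rule phi_le)
    then show ?thesis by simp
  next
    case False
    have "\<exists>l\<in>K - {k}. w $ l \<le> 0"
    proof (rule ccontr)
      assume "\<not> (\<exists>l\<in>K - {k}. w $ l \<le> 0)"
      then have "0 \<le> (\<Sum>l\<in>K - {k}. w $ l)" by (intro sum_nonneg) (meson le_less_linear less_imp_le)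
      moreover have "(\<Sum>l\<in>K. w $ l) = w $ k + (\<Sum>l\<in>K - {k}. w $ l)"
        using \<open>k \<in> K\<close> by (simp add: sum.remove)
      ultimately show False using that(1) False C0 by (simp add: D_def)
    qed
    then obtain l where l: "l \<in> K - {k}" "w $ l \<le> 0" by auto
    have "t w k g \<le> 0" for g
    proof -
      have "Min ((\<lambda>l. w $ l + a g l - a g k) ` (K - {k})) \<le> w $ l + a g l - a g k"
        using l by (intro Min_le) auto
      then have "Min ((\<lambda>l. w $ l + a g l - a g k) ` (K - {k})) - w $ k \<le> 0"
        using C[of g l k] l False by linarith
      then show ?thesis unfolding t_def by linarith
    qed
    then have "\<phi> w k \<le> 0" by (rule phi_le)
    moreover have "w $ k \<le> 2 * C" using that by (simp add: D_def)
    ultimately show ?thesis by simp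
  qed
  have "G ` D \<subseteq> D"
  proof
    fix v assume "v \<in> G ` D"
    then obtain w where w: "w \<in> D" "v = G w" by auto
    have "(\<Sum>k\<in>K. v $ k) = (\<Sum>k\<in>K. w $ k + (\<phi> w k - (\<Sum>l\<in>K. \<phi> w l) / card K) / 2)"
      by (rule sum.cong) (auto simp: w G_def)
    also have "\<dots> = (\<Sum>k\<in>K. w $ k) + ((\<Sum>k\<in>K. \<phi> w k) - (\<Sum>k\<in>K. \<phi> w k)) / 2"
      using cardK by (simp add: sum.distrib sum_subtractf sum_divide_distrib[symmetric])
    finally have "(\<Sum>k\<in>K. v $ k) = 0" using w(1) by (simp add: D_def)
    moreover have "v $ k \<le> 2 * C" for k
    proof (cases "k \<in> K")
      case True
      have "0 \<le> (\<Sum>l\<in>K. \<phi> w l) / card K" by (simp add: phi_nonneg sum_nonneg)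
      then have "(\<phi> w k - (\<Sum>l\<in>K. \<phi> w l) / card K) / 2 \<le> \<phi> w k / 2"
        by (intro divide_right_mono) auto
      then have "w $ k + (\<phi> w k - (\<Sum>l\<in>K. \<phi> w l) / card K) / 2 \<le> 2 * C"
        using phi_bound[OF w(1) True] by (meson add_left_mono order_trans)
      then show ?thesis using True by (simp add: w G_def)
    qed (simp add: w G_def C0)
    ultimately show "v \<in> D" by (simp add: D_def w G_def)
  qed
  moreover have "compact D"
    unfolding compact_eq_bounded_closed
  proof
    have "norm (w $ k) \<le> 2 * C * card K" if w: "w \<in> D" for w k
    proof (cases "k \<in> K")
      case True
      have "- w $ k = (\<Sum>l\<in>K - {k}. w $ l)" using w True by (simp add: D_def sum.remove)
      also have "\<dots> \<le> real (card (K - {k})) * (2 * C)"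
        using w by (intro sum_bounded_above) (simp add: D_def)
      also have "\<dots> \<le> real (card K) * (2 * C)" using C0 by (intro mult_right_mono) (auto simp: card_mono)
      finally have "- w $ k \<le> 2 * C * card K" by (simp add: mult.commute)
      moreover have "2 * C * 1 \<le> 2 * C * card K" using C0 cardK by (intro mult_left_mono) auto
      moreover have "w $ k \<le> 2 * C * 1" using w by (simp add: D_def)
      ultimately show ?thesis unfolding real_norm_def abs_le_iff by linarith
    qed (use w C0 in \<open>simp add: D_def\<close>)
    then have comp: "\<bar>w $ k\<bar> \<le> 2 * C * card K" if "w \<in> D" for w k using that by simp
    have "norm w \<le> (\<Sum>k\<in>(UNIV :: 'n set). 2 * C * card K)" if "w \<in> D" for w
      by (rule order_trans[OF norm_le_l1_cart sum_mono[OF comp[OF that]]])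
    then show "bounded D" by (auto simp: bounded_iff)
    have eq: "D = (\<Inter>k\<in>- K. {w. w $ k = 0}) \<inter> {w. (\<Sum>k\<in>K. w $ k) = 0} \<inter> (\<Inter>k. {w. w $ k \<le> 2 * C})"
      by (auto simp: D_def)
    show "closed D"
      unfolding eq by (intro closed_Int closed_INT ballI closed_Collect_eq closed_Collect_le continuous_intros)
  qed
  moreover have "convex D"
  proof (rule convexI)
    fix x y and u v :: real
    assume *: "x \<in> D" "y \<in> D" "0 \<le> u" "0 \<le> v" "u + v = 1"
    have "(\<Sum>k\<in>K. u * x $ k + v * y $ k) = u * (\<Sum>k\<in>K. x $ k) + v * (\<Sum>k\<in>K. y $ k)"
      by (simp add: sum.distrib sum_distrib_left)
    moreover have "u * x $ k + v * y $ k \<le> 2 * C" for k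
      using * by (intro convex_bound_le) (auto simp: D_def)
    ultimately show "u *\<^sub>R x + v *\<^sub>R y \<in> D" using * by (simp add: D_def)
  qed
  moreover have "0 \<in> D" using C0 by (simp add: D_def)
  moreover have "continuous_on D G"
  proof -
    have "continuous_on D (\<lambda>w. \<phi> w k)" for k
      unfolding \<phi>_def t_def
      by (intro continuous_intros continuous_on_Min_image ne) auto
    note cont = this
    have "continuous_on D (\<lambda>w. if k \<in> K then w $ k + (\<phi> w k - (\<Sum>l\<in>K. \<phi> w l) / card K) / 2 else 0)" for k
    proof (cases "k \<in> K")
      case True
      have "continuous_on D (\<lambda>w. w $ k + (\<phi> w k - (\<Sum>l\<in>K. \<phi> w l) / card K) / 2)"
        using cardK by (intro continuous_intros cont) auto
      then show ?thesis using True by simp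
    qed simp
    then show ?thesis unfolding G_def by (intro continuous_on_vec_lambda)
  qed
  ultimately obtain w where w: "w \<in> D" "G w = w"
    using brouwer[of D G] by (metis empty_iff image_subset_iff_funcset)
  define avg where "avg = (\<Sum>l\<in>K. \<phi> w l) / card K"
  have phi_avg: "\<phi> w k = avg" if "k \<in> K" for k
  proof -
    have "G w $ k = w $ k" using w by simp
    then show ?thesis using that by (simp add: G_def avg_def)
  qed
  obtain k where k: "k \<in> K" "\<And>g. argmins (\<lambda>l. w $ l + a g l) K \<noteq> {k}"
    using no by blast
  have "t w k g = 0" for g
    using k(2)[of g] t_pos[of w k g] t_nonneg[of w k g] argmins_eq_singletonI[OF k(1)] by fastforce
  then have "avg = 0" using phi_avg[OF k(1)] by (simp add: \<phi>_def)
  then have t0: "t w k g = 0" if "k \<in> K" for k g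
    using phi_avg[OF that] t_nonneg by (simp add: \<phi>_def sum_nonneg_eq_0_iff)
  have "2 \<le> card (argmins (\<lambda>l. w $ l + a g l) K)" for g
  proof (rule ccontr)
    assume "\<not> 2 \<le> card (argmins (\<lambda>l. w $ l + a g l) K)"
    moreover have "argmins (\<lambda>l. w $ l + a g l) K \<noteq> {}" using cardK by (intro argmins_nonempty) auto
    then have "card (argmins (\<lambda>l. w $ l + a g l) K) \<noteq> 0" by (simp add: card_eq_0_iff)
    ultimately have "card (argmins (\<lambda>l. w $ l + a g l) K) = 1" by linarith
    then obtain k where k: "argmins (\<lambda>l. w $ l + a g l) K = {k}" by (rule card_1_singletonE)
    then have "k \<in> K" using argmins_subset by fastforce
    then show False using t0[of k g] t_pos[of w k g] argmins_singletonD[OF k] by simp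
  qed
  then show ?thesis by (intro exI[of _ "\<lambda>l. w $ l"]) simp
qed

text \<open>Choose for each column of \<open>K\<close> a row whose only minimiser is that column.
  Adding \<open>w\<close> to the rows changes all permutation sums by the same constant, and
  afterwards every diagonal entry is the strict minimum of its row, so the identity is the unique
  optimal permutation.\<close>

lemma nonsingular_if_unique_argmins:
  fixes M :: "real ^ 'n ^ 'm"
  assumes "card K = r" "0 < r" and u: "\<And>k. k \<in> K \<Longrightarrow> \<exists>g. argmins (\<lambda>l. w l + M $ g $ l) K = {k}"
  shows "has_nonsingular_submatrix r M"
proof -
  have "finite K" using assms card_ge_0_finite by auto
  then obtain \<gamma> where "bij_betw \<gamma> {..<r} K"
    using ex_bij_betw_nat_finite[of K] assms(1) by (auto simp: atLeast0LessThan)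
  then have inj: "inj_on \<gamma> {..<r}" and \<gamma>: "\<And>i. i < r \<Longrightarrow> \<gamma> i \<in> K" by (auto simp: bij_betw_def)
  have "\<forall>i. \<exists>g. i < r \<longrightarrow> argmins (\<lambda>l. w l + M $ g $ l) K = {\<gamma> i}" using u \<gamma> by blast
  then obtain \<rho> where \<rho>: "\<And>i. i < r \<Longrightarrow> argmins (\<lambda>l. w l + M $ \<rho> i $ l) K = {\<gamma> i}" by metis
  have inj\<rho>: "inj_on \<rho> {..<r}"
  proof (rule inj_onI)
    fix x y assume "x \<in> {..<r}" "y \<in> {..<r}" "\<rho> x = \<rho> y"
    then have "\<gamma> x = \<gamma> y" using \<rho>[of x] \<rho>[of y] by simp
    then show "x = y" using inj \<open>x \<in> {..<r}\<close> \<open>y \<in> {..<r}\<close> by (meson inj_onD)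
  qed
  define B where "B = (\<lambda>i j. M $ \<rho> i $ \<gamma> j)"
  have id_less: "(\<Sum>i<r. B i i) < (\<Sum>i<r. B i (\<sigma> i))" if \<sigma>: "\<sigma> permutes {..<r}" "\<sigma> \<noteq> id" for \<sigma>
  proof -
    have lt: "w (\<gamma> i) + B i i < w (\<gamma> (\<sigma> i)) + B i (\<sigma> i)" if i: "i < r" "\<sigma> i \<noteq> i" for i
    proof -
      have "\<sigma> i < r" using \<sigma> i by (meson lessThan_iff permutes_in_image)
      then have "\<gamma> (\<sigma> i) \<noteq> \<gamma> i" "\<gamma> (\<sigma> i) \<in> K" using inj i \<gamma> by (auto dest: inj_onD)
      then show ?thesis using argmins_singletonD[OF \<rho>[OF i(1)]] by (simp add: B_def)
    qed
    obtain i where "i < r" "\<sigma> i \<noteq> i"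
      using \<sigma> by (metis eq_id_iff lessThan_iff permutes_not_in)
    have "(\<Sum>i<r. w (\<gamma> i) + B i i) < (\<Sum>i<r. w (\<gamma> (\<sigma> i)) + B i (\<sigma> i))"
    proof (rule sum_strict_mono_ex1)
      show "\<forall>i\<in>{..<r}. w (\<gamma> i) + B i i \<le> w (\<gamma> (\<sigma> i)) + B i (\<sigma> i)"
      proof
        fix i assume "i \<in> {..<r}"
        then show "w (\<gamma> i) + B i i \<le> w (\<gamma> (\<sigma> i)) + B i (\<sigma> i)" using lt[of i] by (cases "\<sigma> i = i") auto
      qed
      show "\<exists>i\<in>{..<r}. w (\<gamma> i) + B i i < w (\<gamma> (\<sigma> i)) + B i (\<sigma> i)"
        using lt \<open>i < r\<close> \<open>\<sigma> i \<noteq> i\<close> by auto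
    qed simp
    moreover have "(\<Sum>i<r. w (\<gamma> (\<sigma> i))) = (\<Sum>i<r. w (\<gamma> i))"
      using sum.permute[OF \<sigma>(1), of "\<lambda>i. w (\<gamma> i)"] by (simp add: comp_def)
    ultimately show ?thesis by (simp add: sum.distrib)
  qed
  have "\<not> tropically_singular r B"
  proof
    assume "tropically_singular r B"
    then obtain \<sigma> \<tau> where p: "\<sigma> permutes {..<r}" "\<tau> permutes {..<r}" "\<sigma> \<noteq> \<tau>"
      "(\<Sum>i<r. B i (\<sigma> i)) = tropical_det r B" "(\<Sum>i<r. B i (\<tau> i)) = tropical_det r B"
      unfolding tropically_singular_def by blast
    have "tropical_det r B \<le> (\<Sum>i<r. B i (id i))"
      unfolding tropical_det_def
      by (rule Min_le) (auto simp: finite_permutations permutes_id intro!: image_eqI[of _ _ id])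
    then have "\<sigma> = id" "\<tau> = id" using id_less[of \<sigma>] id_less[of \<tau>] p by (auto simp: not_less[symmetric])
    then show False using p(3) by simp
  qed
  then show ?thesis using inj inj\<rho> unfolding has_nonsingular_submatrix_def B_def by blast
qed

subsection \<open>Lifting rows to a stable intersection\<close>

text \<open>A lower bound instead of the order itself: it includes the zero series and survives
  cancellation in sums. The coefficient at \<open>e\<close> is then a leading coefficient that may
  vanish.\<close>

definition ord_ge :: "real \<Rightarrow> gps \<Rightarrow> bool" where
  "ord_ge e f \<longleftrightarrow> (\<forall>a<e. coeff f a = 0)"

lemma ord_ge_gps_ord: "f \<noteq> 0 \<Longrightarrow> ord_ge (gps_ord f) f"
  unfolding ord_ge_def using gps_ord(2) by force

lemma gps_ord_eqI:
  assumes "ord_ge e f" "coeff f e \<noteq> 0"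
  shows "f \<noteq> 0" "gps_ord f = e"
proof -
  show "f \<noteq> 0" using assms(2) by (auto simp: zero_gps.rep_eq)
  show "gps_ord f = e"
    unfolding gps_ord_def using assms by (intro Least_equality) (auto simp: ord_ge_def not_le[symmetric])
qed

lemma ord_ge_zero: "ord_ge e 0"
  by (simp add: ord_ge_def zero_gps.rep_eq)

lemma ord_ge_add: "ord_ge e f \<Longrightarrow> ord_ge e g \<Longrightarrow> ord_ge e (f + g)"
  by (simp add: ord_ge_def plus_gps.rep_eq)

lemma ord_ge_diff: "ord_ge e f \<Longrightarrow> ord_ge e g \<Longrightarrow> ord_ge e (f - g)"
  by (simp add: ord_ge_def minus_gps.rep_eq)

lemma ord_ge_uminus: "ord_ge e f \<Longrightarrow> ord_ge e (- f)"
  by (simp add: ord_ge_def uminus_gps.rep_eq)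

lemma ord_ge_monom: "e \<le> a \<Longrightarrow> ord_ge e (gps_monom c a)"
  by (simp add: ord_ge_def gps_monom.rep_eq)

text \<open>With the exponents of the factors bounded below by \<open>d\<close> and
  \<open>e\<close>, only the pair \<open>(d, e)\<close> contributes to exponent
  \<open>d + e\<close>.\<close>

lemma ord_ge_mult:
  assumes "ord_ge d f" "ord_ge e g"
  shows "ord_ge (d + e) (f * g)" "coeff (f * g) (d + e) = coeff f d * coeff g e"
proof -
  have low: "d \<le> a \<and> e \<le> b - a" if "coeff f a \<noteq> 0" "coeff g (b - a) \<noteq> 0" for a b
    using assms that unfolding ord_ge_def by (metis not_le)
  show "ord_ge (d + e) (f * g)"
    unfolding ord_ge_def
  proof (intro allI impI, rule ccontr)
    fix b assume b: "b < d + e" "coeff (f * g) b \<noteq> 0"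
    obtain a where "coeff f a \<noteq> 0" "coeff g (b - a) \<noteq> 0" by (rule coeff_times_nonzeroE[OF b(2)])
    then show False using low[of a b] b(1) by linarith
  qed
  have "coeff (f * g) (d + e) = (\<Sum>a\<in>{d}. coeff f a * coeff g (d + e - a))"
  proof (rule coeff_times)
    fix a assume "coeff f a \<noteq> 0" "coeff g (d + e - a) \<noteq> 0"
    then have "d \<le> a" "e \<le> d + e - a" using low by blast+
    then show "a \<in> {d}" by simp
  qed simp
  then show "coeff (f * g) (d + e) = coeff f d * coeff g e" by simp
qed

lemma ord_ge_prod:
  assumes "finite I" "\<And>i. i \<in> I \<Longrightarrow> ord_ge (e i) (f i)"
  shows "ord_ge (\<Sum>i\<in>I. e i) (\<Prod>i\<in>I. f i) \<and> coeff (\<Prod>i\<in>I. f i) (\<Sum>i\<in>I. e i) = (\<Prod>i\<in>I. coeff (f i) (e i))"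
  using assms
proof (induction rule: finite_induct)
  case empty
  then show ?case by (simp add: ord_ge_def one_gps.rep_eq)
next
  case (insert i I)
  then show ?case using ord_ge_mult[of "e i" "f i" "\<Sum>i\<in>I. e i" "\<Prod>i\<in>I. f i"] by simp
qed

lemma gps_monom_mult: "gps_monom c a * gps_monom d b = gps_monom (c * d) (a + b)"
  by (rule gps_eqI) (auto simp: coeff_monom_times gps_monom.rep_eq)

text \<open>
  The residue at order 0 of a combination vanishes for one scalar per coordinate at most, and the
  residue field is infinite.
\<close>

lemma residues_nonzero:
  fixes N :: "('n \<Rightarrow> gps) \<Rightarrow> bool"
  assumes "finite I" and zero: "N (\<lambda>_. 0)"
    and closed: "\<And>y z s. N y \<Longrightarrow> N z \<Longrightarrow> N (\<lambda>k. y k + gps_monom s 0 * z k)"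
    and ex: "\<And>k. k \<in> I \<Longrightarrow> \<exists>z. N z \<and> coeff (z k) 0 \<noteq> 0"
  shows "\<exists>y. N y \<and> (\<forall>k\<in>I. coeff (y k) 0 \<noteq> 0)"
  using assms(1) ex
proof (induction rule: finite_induct)
  case empty
  then show ?case using zero by auto
next
  case (insert k I)
  obtain y z where y: "N y" "\<And>l. l \<in> I \<Longrightarrow> coeff (y l) 0 \<noteq> 0" and z: "N z" "coeff (z k) 0 \<noteq> 0"
    using insert.IH[OF insert.prems[OF insertI2]] insert.prems[OF insertI1] by blast
  \<comment> \<open>Where \<open>z l\<close> has residue 0, division by zero merely adds 0 to the
    excluded scalars. Such an \<open>l\<close> differs from \<open>k\<close>, and the nonzero
    residue of \<open>y l\<close> is then unaffected by any \<open>s\<close>.\<close>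
  have "finite ((\<lambda>l. - coeff (y l) 0 / coeff (z l) 0) ` insert k I)" using insert.hyps(1) by simp
  then obtain s where s: "s \<notin> (\<lambda>l. - coeff (y l) 0 / coeff (z l) 0) ` insert k I"
    using ex_new_if_finite[OF infinite_UNIV_char_0] by blast
  have "coeff (y l + gps_monom s 0 * z l) 0 \<noteq> 0" if l: "l \<in> insert k I" for l
  proof
    assume "coeff (y l + gps_monom s 0 * z l) 0 = 0"
    then have eq: "coeff (y l) 0 + s * coeff (z l) 0 = 0" by (simp add: plus_gps.rep_eq coeff_monom_times)
    have "coeff (z l) 0 \<noteq> 0"
    proof (cases "l = k")
      case True
      then show ?thesis using z(2) by simp
    next
      case False
      then have "coeff (y l) 0 \<noteq> 0" using y(2)[of l] l by simp
      then show ?thesis using eq by auto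
    qed
    moreover have "s * coeff (z l) 0 = - coeff (y l) 0" using eq by (simp only: add_eq_0_iff)
    ultimately have "s = - coeff (y l) 0 / coeff (z l) 0" by (simp only: eq_divide_eq) simp
    then show False using s l by blast
  qed
  then show ?case using closed[OF y(1) z(1)] by blast
qed

text \<open>Otherwise \<open>T - {k}\<close> and \<open>T' - {k}\<close> would be the same singleton
  \<open>{l}\<close>, and the cardinalities would force \<open>T = T' = {k, l}\<close>.\<close>

lemma distinct_representatives_avoiding:
  assumes "2 \<le> card T" "2 \<le> card T'" "\<not> (T = T' \<and> card T = 2)"
  shows "\<exists>l\<in>T - {k}. \<exists>m\<in>T' - {k}. l \<noteq> m"
proof (rule ccontr)
  assume "\<not> ?thesis"
  then have *: "x = y" if "x \<in> T" "x \<noteq> k" "y \<in> T'" "y \<noteq> k" for x y using that by auto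
  obtain l where l: "l \<in> T" "l \<noteq> k" using two_le_cardE[OF assms(1)] by metis
  obtain m where m: "m \<in> T'" "m \<noteq> k" using two_le_cardE[OF assms(2)] by metis
  have "T' \<subseteq> {k, l}" using *[OF l] by auto
  moreover have "T \<subseteq> {k, l}" using *[OF _ _ m] *[OF l m] by auto
  moreover have "card {k, l} = 2" using l by simp
  ultimately have "T = {k, l}" "T' = {k, l}"
    using assms(1,2) by (intro card_seteq; simp)+
  then show False using assms(3) \<open>card {k, l} = 2\<close> by simp
qed

text \<open>
  The kernel of the two normalised linear forms contains the cross products supported on three
  coordinates \<open>k\<close>, \<open>l\<close>, \<open>m\<close>; the minor at \<open>l\<close>, \<open>m\<close> is a unit as soon as \<open>l \<in> T\<close> and \<open>m \<in> T'\<close>,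
  because the constants \<open>c\<close> are distinct and nonzero.
\<close>

lemma row_lift:
  fixes u v a :: "'n::finite \<Rightarrow> real" and c :: "'n \<Rightarrow> complex" and K L :: "'n set"
  defines "T \<equiv> argmins (\<lambda>k. u k + a k) K" and "T' \<equiv> argmins (\<lambda>k. v k + a k) L"
  assumes c: "inj c" "\<And>k. c k \<noteq> 0"
    and T: "2 \<le> card T" "2 \<le> card T'" "\<not> (T = T' \<and> card T = 2)"
  shows "\<exists>x. (\<forall>k. x k \<noteq> 0 \<and> gps_ord (x k) = a k) \<and> (\<Sum>k\<in>K. gps_monom 1 (u k) * x k) = 0 \<and>
    (\<Sum>k\<in>L. gps_monom (c k) (v k) * x k) = 0"
proof -
  obtain p where p: "p \<in> T" using two_le_cardE[OF T(1)] by metis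
  obtain q where q: "q \<in> T'" using two_le_cardE[OF T(2)] by metis
  define \<mu> where "\<mu> = u p + a p"
  define \<nu> where "\<nu> = v q + a q"
  \<comment> \<open>The substitution \<open>x k = gps_monom 1 (a k) * y k\<close> and division by
    the monomials of exponents \<open>\<mu>\<close> and \<open>\<nu>\<close> bring both forms to
    order 0. Their residues are then supported exactly on \<open>T\<close> and \<open>T'\<close>,
    and it remains to find a common zero \<open>y\<close> of nonnegative order with all residues
    nonzero.\<close>
  define \<alpha> where "\<alpha> = (\<lambda>k. if k \<in> K then gps_monom 1 (u k + a k - \<mu>) else 0)"
  define \<beta> where "\<beta> = (\<lambda>k. if k \<in> L then gps_monom (c k) (v k + a k - \<nu>) else 0)"
  have ord: "ord_ge 0 (\<alpha> k)" "ord_ge 0 (\<beta> k)" for k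
    using p q by (auto simp: \<alpha>_def \<beta>_def T_def T'_def \<mu>_def \<nu>_def argmins_def intro!: ord_ge_monom ord_ge_zero)
  have T_iff: "k \<in> T \<longleftrightarrow> k \<in> K \<and> u k + a k - \<mu> = 0" for k
    using p argmins_eq_value[of p "\<lambda>k. u k + a k" K k] unfolding T_def \<mu>_def argmins_def by auto
  have T'_iff: "k \<in> T' \<longleftrightarrow> k \<in> L \<and> v k + a k - \<nu> = 0" for k
    using q argmins_eq_value[of q "\<lambda>k. v k + a k" L k] unfolding T'_def \<nu>_def argmins_def by auto
  have res: "coeff (\<alpha> k) 0 = (if k \<in> T then 1 else 0)" "coeff (\<beta> k) 0 = (if k \<in> T' then c k else 0)" for k
    unfolding T_iff T'_iff by (auto simp: \<alpha>_def \<beta>_def gps_monom.rep_eq zero_gps.rep_eq)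
  define minor where "minor = (\<lambda>k l. \<alpha> k * \<beta> l - \<alpha> l * \<beta> k)"
  have ord_minor: "ord_ge 0 (minor k l)" for k l
    unfolding minor_def using ord_ge_mult(1)[OF ord(1) ord(2)] by (intro ord_ge_diff) auto
  have res_minor: "coeff (minor k l) 0 = coeff (\<alpha> k) 0 * coeff (\<beta> l) 0 - coeff (\<alpha> l) 0 * coeff (\<beta> k) 0" for k l
    unfolding minor_def minus_gps.rep_eq using ord_ge_mult(2)[OF ord(1) ord(2)] by simp
  define N where "N = (\<lambda>y. (\<forall>k. ord_ge 0 (y k)) \<and> (\<Sum>k\<in>UNIV. \<alpha> k * y k) = 0 \<and> (\<Sum>k\<in>UNIV. \<beta> k * y k) = 0)"
  have "\<exists>y. N y \<and> (\<forall>k\<in>UNIV. coeff (y k) 0 \<noteq> 0)"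
  proof (rule residues_nonzero)
    show "N (\<lambda>_. 0)" by (simp add: N_def ord_ge_zero)
    show "N (\<lambda>k. y k + gps_monom s 0 * z k)" if "N y" "N z" for y z s
    proof -
      have "ord_ge 0 (gps_monom s 0 * z k)" for k
        using ord_ge_mult(1)[OF ord_ge_monom[of 0 0 s], of 0 "z k"] that by (simp add: N_def)
      moreover have "(\<Sum>k\<in>UNIV. f k * (y k + gps_monom s 0 * z k)) =
          (\<Sum>k\<in>UNIV. f k * y k) + gps_monom s 0 * (\<Sum>k\<in>UNIV. f k * z k)" for f
        by (simp add: algebra_simps sum.distrib sum_distrib_left)
      ultimately show ?thesis using that by (simp add: N_def ord_ge_add)
    qed
    fix k
    obtain l m where lm: "l \<in> T" "l \<noteq> k" "m \<in> T'" "m \<noteq> k" "l \<noteq> m"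
      using distinct_representatives_avoiding[OF T, of k] by blast
    define z where "z = (\<lambda>x. if x = k then minor l m else if x = l then - minor k m else
      if x = m then minor k l else 0)"
    \<comment> \<open>This is the expansion of a determinant with rows \<open>f\<close>,
      \<open>\<alpha>\<close>, \<open>\<beta>\<close> in the columns \<open>k\<close>,
      \<open>l\<close>, \<open>m\<close>; it vanishes for \<open>f = \<alpha>\<close> and
      \<open>f = \<beta>\<close>.\<close>
    have sum: "(\<Sum>x\<in>UNIV. f x * z x) = f k * minor l m - f l * minor k m + f m * minor k l" for f
    proof -
      have "(\<Sum>x\<in>UNIV. f x * z x) = (\<Sum>x\<in>{k, l, m}. f x * z x)"
        by (rule sum.mono_neutral_right) (auto simp: z_def)
      then show ?thesis using lm by (simp add: z_def)
    qed
    have "N z"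
      unfolding N_def sum
      by (auto simp: minor_def algebra_simps) (auto simp: z_def ord_minor ord_ge_uminus ord_ge_zero)
    moreover have "coeff (z k) 0 \<noteq> 0"
      using lm c by (auto simp: z_def res_minor res dest: injD)
    ultimately show "\<exists>z. N z \<and> coeff (z k) 0 \<noteq> 0" by blast
  qed simp
  then obtain y where y: "N y" "\<And>k. coeff (y k) 0 \<noteq> 0" by auto
  define x where "x = (\<lambda>k. gps_monom 1 (a k) * y k)"
  have x: "x k \<noteq> 0 \<and> gps_ord (x k) = a k" for k
  proof -
    have "ord_ge (a k) (x k)"
      using ord_ge_mult(1)[OF ord_ge_monom[of "a k" "a k" 1], of 0 "y k"] y(1) by (simp add: x_def N_def)
    moreover have "coeff (x k) (a k) \<noteq> 0" using y(2) by (simp add: x_def coeff_monom_times)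
    ultimately show ?thesis using gps_ord_eqI by blast
  qed
  have "gps_monom 1 (u k) * x k = gps_monom 1 \<mu> * (\<alpha> k * y k)" if "k \<in> K" for k
    using that by (simp add: x_def \<alpha>_def gps_monom_mult mult.assoc[symmetric])
  then have "(\<Sum>k\<in>K. gps_monom 1 (u k) * x k) = gps_monom 1 \<mu> * (\<Sum>k\<in>K. \<alpha> k * y k)"
    by (simp add: sum_distrib_left)
  also have "(\<Sum>k\<in>K. \<alpha> k * y k) = (\<Sum>k\<in>UNIV. \<alpha> k * y k)"
    by (rule sum.mono_neutral_left) (auto simp: \<alpha>_def)
  finally have K: "(\<Sum>k\<in>K. gps_monom 1 (u k) * x k) = 0" using y(1) by (simp add: N_def)
  have "gps_monom (c k) (v k) * x k = gps_monom 1 \<nu> * (\<beta> k * y k)" if "k \<in> L" for k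
    using that by (simp add: x_def \<beta>_def gps_monom_mult mult.assoc[symmetric])
  then have "(\<Sum>k\<in>L. gps_monom (c k) (v k) * x k) = gps_monom 1 \<nu> * (\<Sum>k\<in>L. \<beta> k * y k)"
    by (simp add: sum_distrib_left)
  also have "(\<Sum>k\<in>L. \<beta> k * y k) = (\<Sum>k\<in>UNIV. \<beta> k * y k)"
    by (rule sum.mono_neutral_left) (auto simp: \<beta>_def)
  finally have "(\<Sum>k\<in>L. gps_monom (c k) (v k) * x k) = 0" using y(1) by (simp add: N_def)
  with x K show ?thesis by blast
qed

text \<open>The first relation omits column \<open>i\<close> and can be solved for column
  \<open>j\<close>, the second omits \<open>j\<close> and can be solved for \<open>i\<close>. So the
  lifted columns other than \<open>i\<close> and \<open>j\<close> span all of them.\<close>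

lemma kapranov_rank_le:
  fixes A :: "real ^ 'n ^ 'g" and W W' :: "'n \<Rightarrow> gps" and x :: "'g \<Rightarrow> 'n \<Rightarrow> gps"
  assumes x: "\<And>g k. x g k \<noteq> 0" "\<And>g k. gps_ord (x g k) = A $ g $ k"
    and "i \<noteq> j"
    and W: "\<And>g. (\<Sum>k\<in>UNIV - {i}. W k * x g k) = 0" "W j \<noteq> 0"
    and W': "\<And>g. (\<Sum>k\<in>UNIV - {j}. W' k * x g k) = 0" "W' i \<noteq> 0"
  shows "kapranov_rank A \<le> CARD('n) - 2"
proof -
  define F :: "'n \<Rightarrow> gps ^ 'g" where "F = (\<lambda>k. \<chi> g. x g k)"
  define S where "S = F ` (UNIV - {i, j})"
  have span: "F p \<in> vec.span S"
    if rel: "\<And>g. (\<Sum>k\<in>UNIV - {q}. W k * x g k) = 0" "W p \<noteq> 0" and pq: "{p, q} = {i, j}" for p q W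
  proof -
    have "p \<noteq> q" using pq \<open>i \<noteq> j\<close> by auto
    have "F p = (\<Sum>k\<in>UNIV - {i, j}. (- (W k / W p)) *s F k)"
    proof (rule Finite_Cartesian_Product.vec_eq_iff[THEN iffD2], rule allI)
      fix g
      have "UNIV - {q} - {p} = UNIV - {i, j}" using pq by auto
      then have "W p * x g p + (\<Sum>k\<in>UNIV - {i, j}. W k * x g k) = 0"
        using rel(1)[of g] \<open>p \<noteq> q\<close> by (simp add: sum.remove[of "UNIV - {q}" p])
      then have "W p * x g p = - (\<Sum>k\<in>UNIV - {i, j}. W k * x g k)" by (simp only: add_eq_0_iff2)
      then have "x g p = - (\<Sum>k\<in>UNIV - {i, j}. W k * x g k) / W p"
        using rel(2) by (metis nonzero_mult_div_cancel_left)
      then show "F p $ g = (\<Sum>k\<in>UNIV - {i, j}. (- (W k / W p)) *s F k) $ g"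
        by (simp add: F_def sum_divide_distrib sum_negf)
    qed
    then show ?thesis
      by (simp only:) (intro vec.span_sum vec.span_scale vec.span_base, auto simp: S_def)
  qed
  have F: "F k \<in> vec.span S" for k
  proof -
    consider "k = i" | "k = j" | "k \<in> UNIV - {i, j}" by auto
    then show ?thesis
    proof cases
      case 1
      then show ?thesis using span[OF W'] by (simp add: insert_commute)
    next
      case 2
      then show ?thesis using span[OF W] by (simp add: insert_commute)
    next
      case 3
      then show ?thesis unfolding S_def by (intro vec.span_base imageI)
    qed
  qed
  define T where "T = (\<lambda>v. \<chi> i. gps_ord (v $ i)) ` {v \<in> vec.span S. \<forall>i. v $ i \<noteq> 0}"
  have "tropical_linear_space (vec.dim (vec.span S)) T"
    unfolding tropical_linear_space_def T_def by (intro exI[of _ "vec.span S"]) simp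
  moreover have "columns A \<subseteq> T"
  proof
    fix a assume "a \<in> columns A"
    then obtain k where "a = column k A" by (auto simp: columns_def)
    then have "a = (\<chi> g. gps_ord (F k $ g))" by (simp add: column_def F_def x Finite_Cartesian_Product.vec_eq_iff)
    moreover have "F k \<in> {v \<in> vec.span S. \<forall>i. v $ i \<noteq> 0}" using F x by (simp add: F_def)
    ultimately show "a \<in> T" unfolding T_def by blast
  qed
  ultimately have "kapranov_rank A \<le> vec.dim (vec.span S)"
    unfolding kapranov_rank_def by (intro Least_le) blast
  also have "\<dots> \<le> card S" unfolding vec.dim_span by (rule vec.dim_le_card') (simp add: S_def)
  also have "\<dots> \<le> card (UNIV - {i, j})" unfolding S_def by (rule card_image_le) simp
  also have "\<dots> = CARD('n) - 2" using \<open>i \<noteq> j\<close> by (subst card_Diff_subset) auto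
  finally show ?thesis .
qed

subsection \<open>Comparison of tropical and Kapranov rank\<close>

text \<open>The vectors form an indexed family, whereas \<open>vec.dependent\<close> sees only the
  set of its values. A repeated vector is therefore treated separately, by the difference of its two
  occurrences.\<close>

lemma nontrivial_relation_if_dim_less:
  fixes F :: "nat \<Rightarrow> 'a::field ^ 'm"
  assumes F: "\<And>j. j < r \<Longrightarrow> F j \<in> V" and dim: "vec.dim V < r"
  shows "\<exists>c. (\<exists>j<r. c j \<noteq> 0) \<and> (\<Sum>j<r. c j *s F j) = 0"
proof (cases "inj_on F {..<r}")
  case True
  have "vec.dependent (F ` {..<r})"
  proof (rule ccontr)
    assume "\<not> vec.dependent (F ` {..<r})"
    moreover have "F ` {..<r} \<subseteq> V" using F by auto
    ultimately have "card (F ` {..<r}) \<le> vec.dim V" by (intro vec.independent_card_le_dim)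
    then show False using dim True by (simp add: card_image)
  qed
  then obtain u where "\<exists>v\<in>F ` {..<r}. u v \<noteq> 0" "(\<Sum>v\<in>F ` {..<r}. u v *s v) = 0"
    by (auto simp: vec.dependent_finite)
  then show ?thesis
    using True by (intro exI[of _ "\<lambda>j. u (F j)"]) (auto simp: sum.reindex)
next
  case False
  then obtain p q where pq: "p < r" "q < r" "F p = F q" "p \<noteq> q" by (auto simp: inj_on_def)
  define c :: "nat \<Rightarrow> 'a" where "c = (\<lambda>j. if j = p then 1 else if j = q then - 1 else 0)"
  have "(\<Sum>j<r. c j *s F j) = (\<Sum>j\<in>{p, q}. c j *s F j)"
    by (rule sum.mono_neutral_right) (use pq in \<open>auto simp: c_def\<close>)
  also have "\<dots> = 0" using pq by (simp add: c_def)
  finally show ?thesis using pq(1) by (intro exI[of _ c]) (auto simp: c_def)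
qed

lemma coeff_signof_mult: "coeff (signof \<sigma> * f) a = of_int (sign \<sigma>) * coeff f a"
  by (cases "evenperm \<sigma>") (simp_all add: sign_def uminus_gps.rep_eq)

text \<open>The Leibniz summand of a permutation has as its order the tropical weight of that
  permutation. The minimal weight belongs to a single permutation, so nothing cancels its leading
  coefficient.\<close>

lemma det_nonzero_if_nonsingular:
  assumes "0 < r" and G: "\<And>i j. i < r \<Longrightarrow> j < r \<Longrightarrow> G i j \<noteq> 0 \<and> gps_ord (G i j) = B i j"
    and ns: "\<not> tropically_singular r B"
  shows "Determinant.det (Matrix.mat r r (\<lambda>(i, j). G i j)) \<noteq> 0"
proof -
  define w where "w = (\<lambda>\<sigma>. \<Sum>i<r. B i (\<sigma> i))"
  define P where "P = {\<sigma>. \<sigma> permutes {..<r}}"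
  have P: "finite P" "id \<in> P" by (auto simp: P_def finite_permutations permutes_id)
  have "tropical_det r B \<in> w ` P"
    unfolding tropical_det_def w_def[symmetric] P_def[symmetric] using P by (intro Min_in) auto
  then obtain \<sigma> where \<sigma>: "\<sigma> \<in> P" "w \<sigma> = tropical_det r B" by auto
  have min: "w \<sigma> \<le> w \<tau>" if "\<tau> \<in> P" for \<tau>
    unfolding \<sigma>(2) tropical_det_def w_def[symmetric] P_def[symmetric] using P that by (intro Min_le) auto
  have less: "w \<sigma> < w \<tau>" if \<tau>: "\<tau> \<in> P" "\<tau> \<noteq> \<sigma>" for \<tau>
  proof (rule ccontr)
    assume "\<not> w \<sigma> < w \<tau>"
    then have "w \<tau> = tropical_det r B" using min[OF \<tau>(1)] \<sigma>(2) by simp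
    then have "tropically_singular r B"
      unfolding tropically_singular_def using \<sigma> \<tau> unfolding w_def P_def by blast
    then show False using ns by simp
  qed
  define summand where "summand = (\<lambda>\<tau>. \<Prod>i<r. G i (\<tau> i))"
  have summand: "ord_ge (w \<tau>) (summand \<tau>)" "coeff (summand \<tau>) (w \<tau>) \<noteq> 0" if "\<tau> \<in> P" for \<tau>
  proof -
    have *: "G i (\<tau> i) \<noteq> 0" "gps_ord (G i (\<tau> i)) = B i (\<tau> i)" if "i < r" for i
    proof -
      have "\<tau> i < r" using that \<open>\<tau> \<in> P\<close> permutes_in_image[of \<tau> "{..<r}" i] unfolding P_def by blast
      then show "G i (\<tau> i) \<noteq> 0" "gps_ord (G i (\<tau> i)) = B i (\<tau> i)" using G[OF that] by blast+
    qed
    have pr: "ord_ge (\<Sum>i<r. B i (\<tau> i)) (\<Prod>i<r. G i (\<tau> i)) \<and>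
      coeff (\<Prod>i<r. G i (\<tau> i)) (\<Sum>i<r. B i (\<tau> i)) = (\<Prod>i<r. coeff (G i (\<tau> i)) (B i (\<tau> i)))"
    proof (rule ord_ge_prod)
      fix i assume "i \<in> {..<r}"
      then have "i < r" by simp
      show "ord_ge (B i (\<tau> i)) (G i (\<tau> i))"
        using ord_ge_gps_ord[OF *(1)[OF \<open>i < r\<close>]] unfolding *(2)[OF \<open>i < r\<close>] .
    qed simp
    then show "ord_ge (w \<tau>) (summand \<tau>)" unfolding w_def summand_def by (rule conjunct1)
    have "coeff (G i (\<tau> i)) (B i (\<tau> i)) \<noteq> 0" if "i < r" for i
      using gps_ord(1)[OF *(1)[OF that]] unfolding *(2)[OF that] .
    then have "(\<Prod>i<r. coeff (G i (\<tau> i)) (B i (\<tau> i))) \<noteq> 0" by simp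
    then show "coeff (summand \<tau>) (w \<tau>) \<noteq> 0" unfolding w_def summand_def conjunct2[OF pr] .
  qed
  have entries: "(\<Prod>i<r. Matrix.mat r r (\<lambda>(i, j). G i j) $$ (i, \<tau> i)) = summand \<tau>" if "\<tau> \<in> P" for \<tau>
    unfolding summand_def
  proof (rule prod.cong)
    fix i assume "i \<in> {..<r}"
    then have "i < r" "\<tau> i < r" using that permutes_in_image[of \<tau> "{..<r}" i] by (simp_all add: P_def)
    then show "Matrix.mat r r (\<lambda>(i, j). G i j) $$ (i, \<tau> i) = G i (\<tau> i)" by simp
  qed simp
  have "Determinant.det (Matrix.mat r r (\<lambda>(i, j). G i j)) =
      (\<Sum>\<tau>\<in>P. signof \<tau> * (\<Prod>i<r. Matrix.mat r r (\<lambda>(i, j). G i j) $$ (i, \<tau> i)))"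
    by (simp only: det_def'[OF mat_carrier] P_def atLeast0LessThan)
  also have "\<dots> = (\<Sum>\<tau>\<in>P. signof \<tau> * summand \<tau>)"
    by (rule sum.cong) (simp_all only: entries)
  finally have "Determinant.det (Matrix.mat r r (\<lambda>(i, j). G i j)) = (\<Sum>\<tau>\<in>P. signof \<tau> * summand \<tau>)" .
  then have "coeff (Determinant.det (Matrix.mat r r (\<lambda>(i, j). G i j))) (w \<sigma>) = (\<Sum>\<tau>\<in>P. coeff (signof \<tau> * summand \<tau>) (w \<sigma>))"
    by (simp add: coeff_sum)
  also have "\<dots> = (\<Sum>\<tau>\<in>{\<sigma>}. coeff (signof \<tau> * summand \<tau>) (w \<sigma>))"
  proof (rule sum.mono_neutral_right)
    show "\<forall>\<tau>\<in>P - {\<sigma>}. coeff (signof \<tau> * summand \<tau>) (w \<sigma>) = 0"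
    proof
      fix \<tau> assume "\<tau> \<in> P - {\<sigma>}"
      then have "coeff (summand \<tau>) (w \<sigma>) = 0" using summand(1)[of \<tau>] less[of \<tau>] by (simp add: ord_ge_def)
      then show "coeff (signof \<tau> * summand \<tau>) (w \<sigma>) = 0" by (simp add: coeff_signof_mult)
    qed
  qed (use P \<sigma> in auto)
  also have "\<dots> \<noteq> 0"
    using summand(2)[OF \<sigma>(1)] by (simp add: coeff_signof_mult sign_def uminus_gps.rep_eq)
  finally show ?thesis by (auto simp: zero_gps.rep_eq)
qed

text \<open>In a smaller space the vectors \<open>F j\<close> satisfy a nontrivial relation. Read in
  the rows \<open>\<rho> i\<close>, its coefficients form a kernel vector of a square matrix whose
  determinant is nonzero.\<close>

lemma dim_ge_if_nonsingular:
  fixes V :: "(gps ^ 'm) set" and F :: "nat \<Rightarrow> gps ^ 'm"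
  assumes "0 < r" and F: "\<And>j. j < r \<Longrightarrow> F j \<in> V"
    and ord: "\<And>i j. i < r \<Longrightarrow> j < r \<Longrightarrow> F j $ \<rho> i \<noteq> 0 \<and> gps_ord (F j $ \<rho> i) = B i j"
    and ns: "\<not> tropically_singular r B"
  shows "r \<le> vec.dim V"
proof (rule ccontr)
  assume "\<not> r \<le> vec.dim V"
  then obtain c where c: "\<exists>j<r. c j \<noteq> 0" "(\<Sum>j<r. c j *s F j) = 0"
    using nontrivial_relation_if_dim_less[of r F V] F by auto
  define M where "M = Matrix.mat r r (\<lambda>(i, j). F j $ \<rho> i)"
  define v where "v = Matrix.vec r c"
  have M: "M \<in> carrier_mat r r" by (simp add: M_def)
  have "v \<noteq> 0\<^sub>v r"
  proof
    assume "v = 0\<^sub>v r"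
    then have "vec_index v j = 0" if "j < r" for j using that by simp
    then show False using c(1) by (auto simp: v_def)
  qed
  moreover have "M *\<^sub>v v = 0\<^sub>v r"
  proof (rule eq_vecI)
    fix i assume "i < dim_vec (0\<^sub>v r :: gps Matrix.vec)"
    then have i: "i < r" by simp
    have "vec_index (M *\<^sub>v v) i = (\<Sum>j<r. F j $ \<rho> i * c j)"
      using i by (simp add: M_def v_def scalar_prod_def atLeast0LessThan)
    also have "\<dots> = (\<Sum>j<r. c j *s F j) $ \<rho> i" by (simp add: mult.commute)
    finally show "vec_index (M *\<^sub>v v) i = vec_index (0\<^sub>v r) i" using i c(2) by simp
  qed (simp add: M_def)
  ultimately have "Determinant.det M = 0" unfolding det_0_iff_vec_prod_zero[OF M] using vec_carrier[of r c] unfolding v_def by blast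
  moreover have "Determinant.det M \<noteq> 0" unfolding M_def using det_nonzero_if_nonsingular[OF assms(1) ord ns] by simp
  ultimately show False by simp
qed

text \<open>A space attaining the Kapranov rank contains lifts of all columns. The lifts of the
  columns of a largest nonsingular submatrix bound its dimension from below.\<close>

lemma tropical_rank_le_kapranov_rank:
  "tropical_rank A \<le> kapranov_rank A"
proof -
  obtain T where "tropical_linear_space (kapranov_rank A) T" and T: "columns A \<subseteq> T"
    using kapranov_rank_attained by blast
  then obtain V where V: "vec.dim V = kapranov_rank A"
      "T = (\<lambda>v. \<chi> i. gps_ord (v $ i)) ` {v \<in> V. \<forall>i. v $ i \<noteq> 0}"
    unfolding tropical_linear_space_def by blast
  have "\<exists>v\<in>V. \<forall>i. v $ i \<noteq> 0 \<and> gps_ord (v $ i) = A $ i $ k" for k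
  proof -
    have "column k A \<in> T" using T by (auto simp: columns_def)
    then obtain v where "v \<in> V" "\<forall>i. v $ i \<noteq> 0" "column k A = (\<chi> i. gps_ord (v $ i))"
      unfolding V by blast
    then show ?thesis by (auto simp: column_def fun_eq_iff intro!: bexI[of _ v])
  qed
  then obtain f where f: "\<And>k. f k \<in> V" "\<And>k i. f k $ i \<noteq> 0 \<and> gps_ord (f k $ i) = A $ i $ k"
    by metis
  obtain \<rho> \<gamma> where ns: "\<not> tropically_singular (tropical_rank A) (\<lambda>i j. A $ \<rho> i $ \<gamma> j)"
    using tropical_rank(1)[of A] unfolding has_nonsingular_submatrix_def by blast
  have "0 < tropical_rank A" using tropical_rank(2)[OF has_nonsingular_submatrix_1, of A] by simp
  then have "tropical_rank A \<le> vec.dim V"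
    by (rule dim_ge_if_nonsingular[where F = "\<lambda>j. f (\<gamma> j)" and \<rho> = \<rho>, OF _ _ _ ns]) (use f in auto)
  then show ?thesis using V(1) by simp
qed

text \<open>If no such \<open>w\<close> exists, some \<open>w\<close> has for each column other than
  \<open>j\<close> a row with its only minimum there, and these rows give a nonsingular submatrix of
  size \<open>CARD('n) - 1\<close>.\<close>

lemma exists_solution_avoiding_column:
  fixes A :: "real ^ 'n ^ 'g"
  assumes "\<not> has_nonsingular_submatrix (CARD('n) - 1) A" "3 \<le> CARD('n)"
  shows "\<exists>w. \<forall>g. 2 \<le> card (argmins (\<lambda>l. w l + A $ g $ l) (UNIV - {j}))"
proof (rule exists_twice_attained)
  have card: "card (UNIV - {j} :: 'n set) = CARD('n) - 1" by (subst card_Diff_subset) auto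
  then show "2 \<le> card (UNIV - {j})" using assms(2) by simp
  show "\<not> (\<exists>w. \<forall>k\<in>UNIV - {j}. \<exists>g. argmins (\<lambda>l. w l + A $ g $ l) (UNIV - {j}) = {k})"
  proof
    assume "\<exists>w. \<forall>k\<in>UNIV - {j}. \<exists>g. argmins (\<lambda>l. w l + A $ g $ l) (UNIV - {j}) = {k}"
    then obtain w where "\<And>k. k \<in> UNIV - {j} \<Longrightarrow> \<exists>g. argmins (\<lambda>l. w l + A $ g $ l) (UNIV - {j}) = {k}"
      by blast
    then have "has_nonsingular_submatrix (CARD('n) - 1) A"
      using assms(2) by (intro nonsingular_if_unique_argmins[OF card]) auto
    then show False using assms(1) by simp
  qed
qed

text \<open>Supplies the leading coefficients of the second linear form. The first has leading
  coefficients 1, and the distinctness keeps the residues of the relevant minors from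
  cancelling.\<close>

lemma inj_nonzero_complex: "\<exists>c :: 'n::finite \<Rightarrow> complex. inj c \<and> (\<forall>k. c k \<noteq> 0)"
proof -
  obtain f :: "'n \<Rightarrow> nat" where f: "inj f"
    using finite_imp_inj_to_nat_seg[of "UNIV :: 'n set"] by blast
  have "inj (\<lambda>k. of_nat (Suc (f k)) :: complex)"
    using f by (simp add: inj_on_def del: of_nat_Suc)
  then show ?thesis by (intro exI[of _ "\<lambda>k. of_nat (Suc (f k))"]) (simp del: of_nat_Suc)
qed

theorem theorem4:
  fixes A :: "real ^ 5 ^ 'g"
  assumes "tropical_rank A = 3"
  shows "kapranov_rank A = 3"
proof (rule antisym)
  show "3 \<le> kapranov_rank A" using tropical_rank_le_kapranov_rank[of A] assms by simp
  have "\<not> has_nonsingular_submatrix 4 A" using tropical_rank(2)[of 4 A] assms by auto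
  then have "\<exists>w. \<forall>g. 2 \<le> card (argmins (\<lambda>l. w l + A $ g $ l) (UNIV - {j}))" for j
    by (intro exists_solution_avoiding_column) auto
  then obtain w where w: "\<And>j g. 2 \<le> card (argmins (\<lambda>l. w j l + A $ g $ l) (UNIV - {j}))"
    by metis
  obtain i j where "i \<noteq> j" and ij: "\<And>g P. argmins (\<lambda>l. w i l + A $ g $ l) (UNIV - {i}) = P \<Longrightarrow>
      argmins (\<lambda>l. w j l + A $ g $ l) (UNIV - {j}) = P \<Longrightarrow> card P \<noteq> 2"
    by (rule stable_pair_exists[of w "\<lambda>g l. A $ g $ l"]) (use w in auto)
  obtain c :: "5 \<Rightarrow> complex" where c: "inj c" "\<And>k. c k \<noteq> 0" using inj_nonzero_complex by blast
  have "\<exists>x. (\<forall>k. x k \<noteq> 0 \<and> gps_ord (x k) = A $ g $ k) \<and>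
      (\<Sum>k\<in>UNIV - {i}. gps_monom 1 (w i k) * x k) = 0 \<and>
      (\<Sum>k\<in>UNIV - {j}. gps_monom (c k) (w j k) * x k) = 0" for g
    by (rule row_lift[OF c w w]) (use ij in blast)
  then obtain x where x: "\<And>g k. x g k \<noteq> 0" "\<And>g k. gps_ord (x g k) = A $ g $ k"
    "\<And>g. (\<Sum>k\<in>UNIV - {i}. gps_monom 1 (w i k) * x g k) = 0"
    "\<And>g. (\<Sum>k\<in>UNIV - {j}. gps_monom (c k) (w j k) * x g k) = 0"
    by metis
  have "kapranov_rank A \<le> CARD(5) - 2"
    by (rule kapranov_rank_le[OF x(1,2) \<open>i \<noteq> j\<close> x(3) _ x(4)]) (simp_all add: gps_monom_nonzero c)
  then show "kapranov_rank A \<le> 3" by simp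
qed

end
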